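(* Among the twelve theta constants $\theta[\tfrac j5;\tfrac k5]$ and $\theta[1;\tfrac j5]$, where $j\in\{1,3\}$ and $k\in\{1,3,5,7,9\}$, there exist at most five which are algebraically independent over $\mathbb{C}$.
   Context: Let $\mathbb{H}^2=\{\tau\in\mathbb{C}:\Im\tau>0\}$. For $(\epsilon,\epsilon')\in\mathbb{R}^2$, $$\theta[\epsilon;\epsilon'](\zeta,\tau)=\sum_{n\in\mathbb{Z}}\exp\Big(2\pi i\Big[\tfrac12\big(n+\tfrac{\epsilon}{2}\big)^2\tau+\big(n+\tfrac{\epsilon}{2}\big)\big(\zeta+\tfrac{\epsilon'}{2}\big)\Big]\Big),$$ and the theta constant $\theta[\epsilon;\epsilon']=\theta[\epsilon;\epsilon'](0,\tau)$ is regarded as a holomorphic function of $\tau\in\mathbb{H}^2$; algebraic independence is as elements of the field of meromorphic functions on $\mathbb{H}^2$. *)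

theory Defs
  imports "HOL-Analysis.Analysis" "HOL-Library.Poly_Mapping"
begin

definition upper_half_plane :: "complex set" where
  "upper_half_plane = {\<tau>. Im \<tau> > 0}"

definition theta_const :: "real \<Rightarrow> real \<Rightarrow> complex \<Rightarrow> complex" where
  "theta_const e e' \<tau> =
     (\<Sum>\<^sub>\<infinity>n::int. exp (2 * complex_of_real pi * \<i> *
        ((complex_of_real ((of_int n + e / 2)^2) / 2) * \<tau>
         + complex_of_real ((of_int n + e / 2) * (e' / 2)))))"

type_synonym 'v cpoly = "('v \<Rightarrow>\<^sub>0 nat) \<Rightarrow>\<^sub>0 complex"

definition monom_eval :: "('v \<Rightarrow>\<^sub>0 nat) \<Rightarrow> ('v \<Rightarrow> complex) \<Rightarrow> complex" where
  "monom_eval m x = prod (\<lambda>v. x v ^ Poly_Mapping.lookup m v) (Poly_Mapping.keys m)"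

definition cpoly_eval :: "'v cpoly \<Rightarrow> ('v \<Rightarrow> complex) \<Rightarrow> complex" where
  "cpoly_eval P x = sum (\<lambda>m. Poly_Mapping.lookup P m * monom_eval m x) (Poly_Mapping.keys P)"

definition alg_indep_on :: "'a set \<Rightarrow> 'v set \<Rightarrow> ('v \<Rightarrow> 'a \<Rightarrow> complex) \<Rightarrow> bool" where
  "alg_indep_on U S f \<longleftrightarrow>
     (\<forall>P :: 'v cpoly. (\<forall>m\<in>Poly_Mapping.keys P. Poly_Mapping.keys m \<subseteq> S) \<longrightarrow>
        (\<forall>\<tau>\<in>U. cpoly_eval P (\<lambda>s. f s \<tau>) = 0) \<longrightarrow> P = 0)"

definition twelve_chars :: "(real \<times> real) set" where
  "twelve_chars = {(j / 5, k / 5) | j k :: real. j \<in> {1, 3} \<and> k \<in> {1, 3, 5, 7, 9}}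
               \<union> {(1, j / 5) | j :: real. j \<in> {1, 3}}"

end

(* The proof shows that any three of the constants are dependent. Up to 200th roots of unity, the theta
   constants with characteristics in (1/5)Z form a finite set of functions that tau + 1 permutes and
   that -1/tau permutes up to a common automorphy factor. The number of coefficients of a ternary form
   of degree 2D grows like D^2, while the number of conditions that all its values on triples from the
   finite set vanish at the cusp to an order proportional to D is only linear in D. So a nonzero form
   satisfies them. Its values, divided by the 2D-th power of the largest modulus in the set, are bounded
   in modulus on a region Im tau >= 4/5 that meets every orbit; invariance carries the bound to
   Im tau = 1/2, and the maximum principle together with the high order of vanishing carries it back
   with half the constant, so all values are 0. *)
theory Submission
  imports Defs "HOL-Complex_Analysis.Complex_Analysis"
begin

text \<open>Inversion is not taken from Poisson summation: uniqueness of Fourier coefficients shows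
  that the entire functions with the multipliers of the Jacobi theta function form a line, and this
  gives one factor for all characteristics. The value of that factor and the notion of weight stay
  out of the proof, since the largest modulus over the family scales exactly like the values and the
  factor cancels. The price is that the family must be closed under both generators, that one form
  must serve all triples at once, and that the denominator must stay away from 0 near the cusp. The
  last is why \<open>theta_const 0 0\<close> belongs to the family: its modulus is at least 1/6 for
  Im tau >= 4/5. The height 4/5 lies below sqrt 3 / 2, so that each reduction step gains a fixed
  factor 10/9, and above 1/2, so that there is room for the maximum principle. The vanishing order
  per degree depends only on the size of the family at Im tau = 1/2, so it can be fixed before the
  degree is chosen; this is what makes the count of conditions against coefficients succeed.\<close>

section \<open>Series over the integers\<close>

text \<open>Completing the square gives A x - \<delta> x^2 <= C - x, which leaves a geometric
  series. The linear term absorbs a bounded argument z, and later the cross term of a shifted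
  square.\<close>

lemma summable_on_int_exp:
  fixes \<delta> A :: real
  assumes "\<delta> > 0"
  shows "(\<lambda>n::int. exp (A * \<bar>of_int n\<bar> - \<delta> * (of_int n)\<^sup>2)) summable_on UNIV"
proof -
  have geo: "(\<lambda>n::nat. exp (- real n)) summable_on UNIV"
  proof (rule norm_summable_imp_summable_on)
    have "summable (\<lambda>n. exp (-1::real) ^ n)" by (rule summable_geometric) simp
    then show "summable (\<lambda>n. norm (exp (- real n)))"
      by (simp add: exp_of_nat_mult[symmetric])
  qed
  have "bij_betw int UNIV {0..}" "bij_betw (\<lambda>n. - int n) UNIV {..0}"
    by (rule bij_betwI[where g=nat], auto) (rule bij_betwI[where g="\<lambda>n. nat (- n)"], auto)
  from this[THEN summable_on_reindex_bij_betw, of "\<lambda>n. exp (- \<bar>of_int n\<bar> :: real)"] geo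
  have "(\<lambda>n::int. exp (- \<bar>of_int n\<bar> :: real)) summable_on {0..}"
    "(\<lambda>n::int. exp (- \<bar>of_int n\<bar> :: real)) summable_on {..0}" by simp_all
  then have "(\<lambda>n::int. exp (- \<bar>of_int n\<bar> :: real)) summable_on ({0..} \<union> ({..0} - {0}))"
    by (intro summable_on_Un_disjoint) (auto intro: summable_on_subset_banach)
  moreover have "{0..} \<union> ({..0} - {0}) = (UNIV :: int set)" by auto
  ultimately have base: "(\<lambda>n::int. exp (- \<bar>of_int n\<bar> :: real)) summable_on UNIV" by simp
  define C where "C = (A + 1)\<^sup>2 / (4 * \<delta>)"
  show ?thesis
  proof (rule summable_on_comparison_test[OF summable_on_cmult_right[OF base, of "exp C"]])
    fix n :: int
    define x where "x = \<bar>of_int n :: real\<bar>"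
    have "0 \<le> \<delta> * (x - (A + 1) / (2 * \<delta>))\<^sup>2" using assms by simp
    also have "\<dots> = \<delta> * x\<^sup>2 - (A + 1) * x + C"
      using assms by (simp add: C_def power2_eq_square field_simps)
    finally have "A * x - \<delta> * x\<^sup>2 \<le> C - x" by (simp add: algebra_simps)
    then have "exp (A * x - \<delta> * x\<^sup>2) \<le> exp C * exp (- x)"
      by (simp add: exp_add[symmetric])
    then show "exp (A * \<bar>of_int n\<bar> - \<delta> * (of_int n)\<^sup>2) \<le> exp C * exp (- \<bar>of_int n\<bar>)"
      by (simp add: x_def)
  qed auto
qed

text \<open>Weierstrass test on a small closed disk around each point. The majorant may depend on
  the disk, as it must for theta series, which have no summable bound on the whole plane or the
  whole unit disk.\<close>

lemma holomorphic_on_infsum: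
  fixes f :: "'i \<Rightarrow> complex \<Rightarrow> complex"
  assumes "open U" and hol: "\<And>n. f n holomorphic_on U"
    and dom: "\<And>z. z \<in> U \<Longrightarrow> \<exists>e>0. \<exists>M. M summable_on I \<and> (\<forall>n\<in>I. \<forall>w\<in>ball z e. norm (f n w) \<le> M n)"
  shows "(\<lambda>z. \<Sum>\<^sub>\<infinity>n\<in>I. f n z) holomorphic_on U"
proof -
  have "\<exists>r>0. (\<lambda>z. \<Sum>\<^sub>\<infinity>n\<in>I. f n z) holomorphic_on ball z r" if z: "z \<in> U" for z
  proof -
    obtain e M where e: "e > 0" "M summable_on I" "\<And>n w. n \<in> I \<Longrightarrow> w \<in> ball z e \<Longrightarrow> norm (f n w) \<le> M n"
      using dom[OF z] by blast
    obtain d where d: "d > 0" "cball z d \<subseteq> U" using \<open>open U\<close> z open_contains_cball by blast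
    define r where "r = min d (e / 2)"
    have r: "r > 0" "cball z r \<subseteq> U" "cball z r \<subseteq> ball z e"
      using d e(1) by (auto simp: r_def subset_iff)
    have ul: "uniform_limit (cball z r) (\<lambda>X y. \<Sum>n\<in>X. f n y) (\<lambda>y. \<Sum>\<^sub>\<infinity>n\<in>I. f n y) (finite_subsets_at_top I)"
      using r(3) by (intro Weierstrass_m_test_general[OF _ e(2)] e(3)) auto
    have "(\<lambda>z. \<Sum>n\<in>X. f n z) holomorphic_on cball z r" for X
      using holomorphic_on_subset[OF hol r(2)] by (intro holomorphic_intros)
    then show ?thesis
      using holomorphic_uniform_limit[OF _ ul] r(1)
      by (metis (mono_tags, lifting) always_eventually ball_subset_cball finite_subsets_at_top_neq_bot
          holomorphic_on_imp_continuous_on holomorphic_on_subset)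
  qed
  then show ?thesis
    unfolding holomorphic_on_def
    by (metis at_within_open centre_in_ball field_differentiable_at_within open_ball)
qed

section \<open>The Jacobi theta function\<close>

lemma exp_two_pi_of_int: "exp (2 * complex_of_real pi * \<i> * of_int n) = 1"
  using exp_integer_2pi[of "of_int n"] by (simp add: ac_simps)

text \<open>Jacobi's theta_3 with periods normalised to 1 and \<tau>. Every characteristic arises
  from it by moving z to (e \<tau> + e') / 2, so that inversion needs a proof only for this one
  function.\<close>

definition jac :: "complex \<Rightarrow> complex \<Rightarrow> complex" where
  "jac \<tau> z = (\<Sum>\<^sub>\<infinity>n::int. exp (pi * \<i> * of_int n ^ 2 * \<tau> + 2 * pi * \<i> * of_int n * z))"

lemma norm_jac_term_le:
  assumes "cmod z \<le> R"
  shows "cmod (exp (pi * \<i> * of_int n ^ 2 * \<tau> + 2 * pi * \<i> * of_int n * z))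
           \<le> exp (2 * pi * R * \<bar>of_int n\<bar> - pi * Im \<tau> * (of_int n)\<^sup>2)"
proof -
  have "\<bar>Im z\<bar> \<le> R" using assms abs_Im_le_cmod order_trans by blast
  then have "- (real_of_int n * Im z) \<le> \<bar>of_int n\<bar> * R"
    by (metis abs_ge_minus_self abs_mult abs_ge_zero mult_left_mono order_trans)
  then have "pi * (- (of_int n * Im z)) \<le> pi * (\<bar>of_int n\<bar> * R)"
    by (intro mult_left_mono) auto
  then show ?thesis by (simp add: power2_eq_square algebra_simps)
qed

lemma jac_term_summable:
  assumes "Im \<tau> > 0"
  shows "(\<lambda>n::int. exp (pi * \<i> * of_int n ^ 2 * \<tau> + 2 * pi * \<i> * of_int n * z)) summable_on UNIV"
proof (rule abs_summable_summable[OF summable_on_comparison_test])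
  show "(\<lambda>n::int. exp (2 * pi * cmod z * \<bar>of_int n\<bar> - pi * Im \<tau> * (of_int n)\<^sup>2)) summable_on UNIV"
    using assms by (intro summable_on_int_exp) auto
  show "norm (exp (pi * \<i> * of_int n ^ 2 * \<tau> + 2 * pi * \<i> * of_int n * z))
      \<le> exp (2 * pi * cmod z * \<bar>of_int n\<bar> - pi * Im \<tau> * (of_int n)\<^sup>2)" for n :: int
    by (rule norm_jac_term_le) simp
qed simp

lemma jac_holomorphic:
  assumes "Im \<tau> > 0"
  shows "jac \<tau> holomorphic_on UNIV"
  unfolding jac_def[abs_def]
proof (rule holomorphic_on_infsum)
  fix z :: complex
  let ?M = "\<lambda>n::int. exp (2 * pi * (cmod z + 1) * \<bar>of_int n\<bar> - pi * Im \<tau> * (of_int n)\<^sup>2)"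
  have "?M summable_on UNIV" using assms by (intro summable_on_int_exp) auto
  moreover have "cmod w \<le> cmod z + 1" if "w \<in> ball z 1" for w
    using that norm_triangle_sub[of w z] by (simp add: dist_norm norm_minus_commute)
  ultimately show "\<exists>e>0. \<exists>M. M summable_on UNIV \<and> (\<forall>n\<in>UNIV. \<forall>w\<in>ball z e.
      cmod (exp (pi * \<i> * of_int n ^ 2 * \<tau> + 2 * pi * \<i> * of_int n * w)) \<le> M n)"
    by (intro exI[of _ "1::real"] conjI exI[of _ ?M] ballI norm_jac_term_le) auto
qed (auto intro!: holomorphic_intros)

lemma jac_plus_one: "jac \<tau> (z + 1) = jac \<tau> z"
  unfolding jac_def
proof (rule infsum_cong)
  fix n :: int
  show "exp (pi * \<i> * of_int n ^ 2 * \<tau> + 2 * pi * \<i> * of_int n * (z + 1))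
      = exp (pi * \<i> * of_int n ^ 2 * \<tau> + 2 * pi * \<i> * of_int n * z)"
    using exp_two_pi_of_int[of n] by (simp add: distrib_left exp_add)
qed

text \<open>Since n^2 + 2 n = (n + 1)^2 - 1, moving z by \<tau> amounts to shifting the summation
  index by 1.\<close>

lemma jac_plus_tau: "jac \<tau> (z + \<tau>) = exp (- (pi * \<i> * \<tau>) - 2 * pi * \<i> * z) * jac \<tau> z"
proof -
  let ?f = "\<lambda>n::int. exp (pi * \<i> * of_int n ^ 2 * \<tau> + 2 * pi * \<i> * of_int n * z)"
  have "jac \<tau> (z + \<tau>) = (\<Sum>\<^sub>\<infinity>n. exp (- (pi * \<i> * \<tau>) - 2 * pi * \<i> * z) * ?f (n + 1))"
    unfolding jac_def
    by (rule infsum_cong) (simp add: exp_add[symmetric] power2_eq_square algebra_simps)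
  also have "\<dots> = exp (- (pi * \<i> * \<tau>) - 2 * pi * \<i> * z) * (\<Sum>\<^sub>\<infinity>n. ?f (n + 1))"
    by (rule infsum_cmult_right')
  also have "(\<Sum>\<^sub>\<infinity>n. ?f (n + 1)) = (\<Sum>\<^sub>\<infinity>n. ?f n)"
    by (rule infsum_reindex_bij_betw) (auto intro!: bij_betwI[where g="\<lambda>n. n - 1"])
  finally show ?thesis by (simp add: jac_def)
qed

section \<open>Uniqueness of Fourier coefficients\<close>

definition fourier_char :: "int \<Rightarrow> real \<Rightarrow> complex" where
  "fourier_char k t = exp (2 * pi * \<i> * of_int k * of_real t)"

lemma fourier_char_add: "fourier_char (j + k) t = fourier_char j t * fourier_char k t"
  by (simp add: fourier_char_def exp_add[symmetric] algebra_simps)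

lemma continuous_on_fourier_char [continuous_intros]: "continuous_on A (fourier_char k)"
  unfolding fourier_char_def by (intro continuous_intros)

lemma fourier_char_in_sphere: "fourier_char k t \<in> sphere 0 1"
  by (simp add: fourier_char_def)

definition fourier_null :: "(real \<Rightarrow> complex) set" where
  "fourier_null = {g. continuous_on {0..1} g \<and> (\<forall>k. integral {0..1} (\<lambda>t. g t * fourier_char k t) = 0)}"

lemma fourier_null_add:
  assumes "g \<in> fourier_null" "h \<in> fourier_null"
  shows "(\<lambda>t. g t + h t) \<in> fourier_null"
  using assms unfolding fourier_null_def
  by (auto simp: distrib_right intro!: continuous_intros, subst integral_add)
     (auto intro!: integrable_continuous_real continuous_intros)

lemma fourier_null_cmult:
  assumes "g \<in> fourier_null"
  shows "(\<lambda>t. c * g t) \<in> fourier_null"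
  using assms unfolding fourier_null_def
  by (auto simp: mult.assoc intro!: continuous_intros)

lemma fourier_null_mult_char:
  assumes "g \<in> fourier_null"
  shows "(\<lambda>t. g t * fourier_char k t) \<in> fourier_null"
  using assms unfolding fourier_null_def
  by (auto simp: mult.assoc fourier_char_add[symmetric] intro!: continuous_intros)

text \<open>On the circle a real polynomial in w is a trigonometric polynomial, because there the
  conjugate of w is 1 / w. In the induction \<open>g\<close> varies, since a product is handled by
  multiplying with one factor after the other.\<close>

lemma fourier_null_mult_poly:
  assumes "real_polynomial_function p" "g \<in> fourier_null"
  shows "(\<lambda>t. g t * of_real (p (fourier_char 1 t))) \<in> fourier_null"
  using assms
proof (induction arbitrary: g)
  case (linear p)
  interpret bounded_linear p by fact
  \<comment> \<open>A real-linear functional on the complex plane is a combination of w and its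
    conjugate, with coefficients determined by its values at 1 and at the imaginary unit.\<close>
  have dec: "of_real (p w) = (of_real (p 1) - \<i> * of_real (p \<i>)) / 2 * w
      + (of_real (p 1) + \<i> * of_real (p \<i>)) / 2 * cnj w" for w
  proof -
    have "w = Re w *\<^sub>R 1 + Im w *\<^sub>R \<i>" by (simp add: complex_eq_iff)
    then have "p w = Re w * p 1 + Im w * p \<i>" by (metis add scaleR real_scaleR_def)
    then show ?thesis by (simp add: complex_eq_iff field_simps)
  qed
  have cnj: "cnj (fourier_char 1 t) = fourier_char (-1) t" for t
    by (simp add: fourier_char_def exp_cnj)
  have "(\<lambda>t. g t * of_real (p (fourier_char 1 t))) =
      (\<lambda>t. (of_real (p 1) - \<i> * of_real (p \<i>)) / 2 * (g t * fourier_char 1 t)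
         + (of_real (p 1) + \<i> * of_real (p \<i>)) / 2 * (g t * fourier_char (-1) t))"
    unfolding dec[of "fourier_char 1 _"] cnj by (simp add: algebra_simps)
  then show ?case
    by (simp only:) (intro fourier_null_add fourier_null_cmult fourier_null_mult_char linear.prems)
next
  case (const c)
  then show ?case by (subst mult.commute) (rule fourier_null_cmult)
next
  case (add p q)
  then show ?case using fourier_null_add by (simp add: distrib_left)
next
  case (mult p q)
  from mult.IH(2)[OF mult.IH(1)[OF mult.prems]] show ?case by (simp add: mult.assoc)
qed

text \<open>By Stone-Weierstrass u is a uniform limit of polynomials on the circle, and g integrates
  to 0 against each of them. Taking u real-valued fits the real form of that theorem; complex
  functions enter through their real and imaginary parts.\<close>

lemma fourier_null_integral_circle:
  fixes u :: "complex \<Rightarrow> real"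
  assumes g: "g \<in> fourier_null" and u: "continuous_on (sphere 0 1) u"
  shows "integral {0..1} (\<lambda>t. g t * of_real (u (fourier_char 1 t))) = 0"
proof -
  let ?J = "integral {0..1} (\<lambda>t. g t * of_real (u (fourier_char 1 t)))"
  have cg: "continuous_on {0..1} g" using g by (simp add: fourier_null_def)
  have "bounded (g ` {0..1})" by (intro compact_imp_bounded compact_continuous_image cg) auto
  then obtain B where B: "\<And>t. t \<in> {0..1} \<Longrightarrow> norm (g t) \<le> B"
    unfolding bounded_iff by blast
  have "B \<ge> 0" using B[of 0] norm_ge_zero[of "g 0"] by (simp del: norm_ge_zero)
  have cu: "continuous_on {0..1} (\<lambda>t. u (fourier_char 1 t))"
    by (rule continuous_on_compose2[OF u continuous_on_fourier_char]) (use fourier_char_in_sphere in blast)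
  have "norm ?J \<le> B * e" if "e > 0" for e
  proof -
    obtain p where p: "real_polynomial_function p" "\<And>w. w \<in> sphere 0 1 \<Longrightarrow> \<bar>u w - p w\<bar> < e"
      using Stone_Weierstrass_real_polynomial_function[OF compact_sphere u \<open>e > 0\<close>] by metis
    let ?h = "\<lambda>t. g t * of_real (p (fourier_char 1 t))"
    have h: "?h \<in> fourier_null" using fourier_null_mult_poly[OF p(1) g] .
    then have ch: "continuous_on {0..1} ?h" by (simp add: fourier_null_def)
    \<comment> \<open>The coefficient at k = 0 is the plain integral.\<close>
    have "integral {0..1} (\<lambda>t. ?h t * fourier_char 0 t) = 0"
      using h by (simp add: fourier_null_def)
    then have "integral {0..1} ?h = 0" by (simp add: fourier_char_def)
    then have "?J = integral {0..1} (\<lambda>t. g t * of_real (u (fourier_char 1 t)) - ?h t)"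
      using cg cu ch by (subst integral_diff) (auto intro!: integrable_continuous_real continuous_intros)
    also have "norm \<dots> \<le> (B * e) * (1 - 0)"
    proof (rule integral_bound)
      fix t :: real assume t: "t \<in> {0..1}"
      have "norm (g t * of_real (u (fourier_char 1 t)) - ?h t) = norm (g t) * \<bar>u (fourier_char 1 t) - p (fourier_char 1 t)\<bar>"
        by (metis norm_mult norm_of_real of_real_diff right_diff_distrib)
      also have "\<dots> \<le> B * e"
        using B[OF t] p(2)[OF fourier_char_in_sphere] \<open>B \<ge> 0\<close> by (intro mult_mono) (auto intro: less_imp_le)
      finally show "norm (g t * of_real (u (fourier_char 1 t)) - ?h t) \<le> B * e" .
    qed (use cg cu ch in \<open>auto intro!: continuous_intros\<close>)
    finally show ?thesis by simp
  qed note * = this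
  have small: "norm ?J \<le> e" if "e > 0" for e
  proof -
    \<comment> \<open>The denominator B + 1 instead of B also covers B = 0.\<close>
    have "norm ?J \<le> B * (e / (B + 1))" using \<open>B \<ge> 0\<close> that by (intro *) simp
    also have "\<dots> \<le> e" using \<open>B \<ge> 0\<close> that by (simp add: field_simps)
    finally show ?thesis .
  qed
  have "norm ?J \<le> 0" by (rule field_le_epsilon, subst add_0, rule small)
  then show ?thesis by simp
qed

lemma periodic_shift_int:
  fixes f :: "complex \<Rightarrow> complex"
  assumes "\<And>z. f (z + 1) = f z"
  shows "f (z + of_int n) = f z"
proof -
  have nat: "f (w + of_nat m) = f w" for w m
  proof (induction m)
    case (Suc m)
    have "f (w + of_nat (Suc m)) = f (w + of_nat m + 1)" by (simp add: ac_simps)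
    then show ?case using Suc assms by simp
  qed simp
  show ?thesis
  proof (cases "n \<ge> 0")
    case True
    then show ?thesis using nat[of z "nat n"] by simp
  next
    case False
    then show ?thesis using nat[of "z + of_int n" "nat (- n)"] by simp
  qed
qed

text \<open>The function is G(w) = f(log w / (2 pi i)). The principal branch of the logarithm is
  continuous only off the nonpositive axis; by periodicity the branch Ln (- w) / (2 pi i) + 1/2
  gives the same G and is continuous off the nonnegative axis. The two domains cover everything but
  0.\<close>

lemma periodic_descends_to_circle:
  fixes f :: "complex \<Rightarrow> complex"
  assumes f: "continuous_on UNIV f" and per: "\<And>z. f (z + 1) = f z"
  obtains G where "continuous_on (- {0}) G" "\<And>z. G (exp (2 * pi * \<i> * z)) = f z"
proof
  define G where "G = (\<lambda>w. f (Ln w / (2 * pi * \<i>)))"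
  have G: "G (exp (2 * pi * \<i> * z)) = f z" for z
  proof -
    have "exp (Ln (exp (2 * pi * \<i> * z))) = exp (2 * pi * \<i> * z)" by simp
    then obtain n :: int where "Ln (exp (2 * pi * \<i> * z)) = 2 * pi * \<i> * z + (of_int (2 * n) * pi) * \<i>"
      unfolding exp_eq by auto
    then have "Ln (exp (2 * pi * \<i> * z)) / (2 * pi * \<i>) = z + of_int n"
      by (simp add: field_simps)
    then show ?thesis unfolding G_def using periodic_shift_int[of f, OF per] by simp
  qed
  then show "\<And>z. G (exp (2 * pi * \<i> * z)) = f z" .
  have 1: "continuous_on (- \<real>\<^sub>\<le>\<^sub>0) G"
    unfolding G_def by (intro continuous_on_compose2[OF f] continuous_intros) auto
  have G2: "G w = f (Ln (- w) / (2 * pi * \<i>) + 1 / 2)" if "w \<noteq> 0" for w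
  proof -
    have "exp (2 * pi * \<i> * (Ln (- w) / (2 * pi * \<i>) + 1 / 2)) = exp (Ln (-w) + pi * \<i>)"
      by (simp add: distrib_left)
    also have "\<dots> = w" using that by (simp add: exp_add)
    finally show ?thesis by (metis G)
  qed
  have "continuous_on (uminus -` (- \<real>\<^sub>\<le>\<^sub>0)) (\<lambda>w. f (Ln (- w) / (2 * pi * \<i>) + 1 / 2))"
    by (intro continuous_on_compose2[OF f] continuous_intros) auto
  then have 2: "continuous_on (uminus -` (- \<real>\<^sub>\<le>\<^sub>0)) G"
  proof (rule continuous_on_eq)
    fix w :: complex assume "w \<in> uminus -` (- \<real>\<^sub>\<le>\<^sub>0)"
    then have "w \<noteq> 0" by auto
    then show "f (Ln (- w) / (2 * pi * \<i>) + 1 / 2) = G w" by (rule G2[symmetric])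
  qed
  have "open (- \<real>\<^sub>\<le>\<^sub>0 :: complex set)" by (simp add: closed_nonpos_Reals_complex open_Compl)
  moreover from this have "open (uminus -` (- \<real>\<^sub>\<le>\<^sub>0 :: complex set))"
    by (rule open_vimage) (intro continuous_intros)
  ultimately have "continuous_on (- \<real>\<^sub>\<le>\<^sub>0 \<union> uminus -` (- \<real>\<^sub>\<le>\<^sub>0)) G"
    using 1 2 by (intro continuous_on_open_Un) auto
  moreover have "- {0} \<subseteq> - \<real>\<^sub>\<le>\<^sub>0 \<union> uminus -` (- \<real>\<^sub>\<le>\<^sub>0 :: complex set)"
    by (auto simp: complex_nonpos_Reals_iff complex_eq_iff)
  ultimately show "continuous_on (- {0}) G" by (rule continuous_on_subset)
qed

text \<open>The squared modulus of f is f Re f - i f Im f. Both products integrate to 0 because Re f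
  and Im f come from continuous functions on the circle, so f vanishes on [0,1], and the identity
  theorem finishes.\<close>

lemma periodic_entire_eq_0:
  assumes f: "f holomorphic_on UNIV" and per: "\<And>z. f (z + 1) = f z"
    and null: "\<And>k. integral {0..1} (\<lambda>t. f (of_real t) * fourier_char k t) = 0"
  shows "f z = 0"
proof -
  have cf: "continuous_on UNIV f" using f holomorphic_on_imp_continuous_on by blast
  obtain G where G: "continuous_on (- {0}) G" "\<And>z. G (exp (2 * pi * \<i> * z)) = f z"
    using periodic_descends_to_circle[OF cf per] by blast
  have cG: "continuous_on (sphere 0 1) G" by (rule continuous_on_subset[OF G(1)]) auto
  have Gc: "G (fourier_char 1 t) = f (of_real t)" for t using G(2)[of "of_real t"] by (simp add: fourier_char_def)
  let ?f = "\<lambda>t::real. f (of_real t)"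
  have c: "continuous_on {0..1} ?f" by (intro continuous_on_compose2[OF cf] continuous_intros) auto
  with null have "?f \<in> fourier_null" by (simp add: fourier_null_def)
  from fourier_null_integral_circle[OF this continuous_on_Re[OF cG]]
    fourier_null_integral_circle[OF this continuous_on_Im[OF cG]]
  have R: "integral {0..1} (\<lambda>t. ?f t * of_real (Re (?f t))) = 0"
    and I: "integral {0..1} (\<lambda>t. ?f t * of_real (Im (?f t))) = 0"
    by (simp_all add: Gc)
  have "complex_of_real ((cmod (?f t))\<^sup>2) = ?f t * of_real (Re (?f t)) - \<i> * (?f t * of_real (Im (?f t)))" for t
    unfolding cmod_power2 by (simp add: complex_eq_iff power2_eq_square)
  then have "integral {0..1} (\<lambda>t. complex_of_real ((cmod (?f t))\<^sup>2)) =
     integral {0..1} (\<lambda>t. ?f t * of_real (Re (?f t)) - \<i> * (?f t * of_real (Im (?f t))))" by (simp only:)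
  also have "\<dots> = 0"
  proof -
    have "(\<lambda>t. ?f t * of_real (Re (?f t))) integrable_on {0..1}"
      "(\<lambda>t. \<i> * (?f t * of_real (Im (?f t)))) integrable_on {0..1}"
      by (intro integrable_continuous_real continuous_intros c)+
    from integral_diff[OF this] show ?thesis using R I by simp
  qed
  finally have 0: "integral {0..1} (\<lambda>t. complex_of_real ((cmod (?f t))\<^sup>2)) = 0" .
  have cn: "continuous_on {0..1} (\<lambda>t. (cmod (?f t))\<^sup>2)" by (intro continuous_intros c)
  from integral_linear[OF integrable_continuous_real[OF this] bounded_linear_of_real[where ?'a=complex]] 0
  have "integral {0..1} (\<lambda>t. (cmod (?f t))\<^sup>2) = 0" by (simp add: o_def)
  then have "\<forall>t\<in>{0..1}. (cmod (?f t))\<^sup>2 = 0"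
    by (subst (asm) integral_eq_0_iff[OF cn]) simp_all
  then have zero: "f (of_real t) = 0" if "t \<in> {0..1}" for t using that by simp
  show ?thesis
  proof (rule analytic_continuation[OF f])
    show "of_real ` {0..1} \<subseteq> (UNIV :: complex set)" by simp
    show "(0::complex) islimpt of_real ` {0..1}"
    proof (subst islimpt_sequential, intro exI conjI allI)
      show "complex_of_real (1 / real (Suc n)) \<in> of_real ` {0..1} - {0}" for n
        by (intro DiffI imageI) (auto simp del: of_nat_Suc)
      have "(\<lambda>n. complex_of_real (1 / real (Suc n))) \<longlonglongrightarrow> of_real 0"
        by (intro tendsto_of_real lim_1_over_n[THEN LIMSEQ_Suc])
      then show "(\<lambda>n. complex_of_real (1 / real (Suc n))) \<longlonglongrightarrow> 0" by simp
    qed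
  qed (use zero in auto)
qed

section \<open>Inversion of the Jacobi theta function\<close>

text \<open>With a primitive F the integral over the segment from s to s + 1 is F(s + 1) - F(s),
  whose derivative in s is f(s + 1) - f(s) = 0. Here s is complex, so the segment may be moved
  vertically.\<close>

lemma periodic_integral_shift:
  assumes f: "f holomorphic_on UNIV" and per: "\<And>z. f (z + 1) = f z"
  shows "integral {0..1} (\<lambda>t. f (s + of_real t)) = integral {0..1} (\<lambda>t. f (of_real t))"
proof -
  obtain F where F: "\<And>z. (F has_field_derivative f z) (at z)"
    using holomorphic_convex_primitive'[OF convex_UNIV open_UNIV f] by auto
  have "((\<lambda>t. f (z + of_real t)) has_integral F (z + of_real 1) - F (z + of_real 0)) {0..1}" for z
  proof (rule fundamental_theorem_of_calculus)
    fix t :: real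
    have "((\<lambda>w. z + w) has_field_derivative 1) (at (of_real t))"
      by (auto intro!: derivative_eq_intros)
    from DERIV_chain2[OF F this]
    have "((\<lambda>w. F (z + w)) has_field_derivative f (z + of_real t)) (at (of_real t))" by simp
    then show "((\<lambda>t. F (z + of_real t)) has_vector_derivative f (z + of_real t)) (at t within {0..1})"
      by (rule has_vector_derivative_real_field)
  qed simp
  then have int: "integral {0..1} (\<lambda>t. f (z + of_real t)) = F (z + 1) - F z" for z
    by (metis integral_unique of_real_0 of_real_1 add_0_right)
  have "((\<lambda>z. F (z + 1) - F z) has_field_derivative 0) (at z within UNIV)" for z
  proof -
    have "((\<lambda>w. w + 1) has_field_derivative 1) (at z)"
      by (auto intro!: derivative_eq_intros)
    from DERIV_diff[OF DERIV_chain2[OF F this] F[of z]] show ?thesis by (simp add: per)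
  qed
  then have "\<exists>c. \<forall>z\<in>UNIV. F (z + 1) - F z = c"
    by (intro has_field_derivative_zero_constant) auto
  then obtain c where c: "\<And>z. F (z + 1) - F z = c" by blast
  show ?thesis using int[of s] int[of 0] c[of s] c[of 0] by simp
qed

lemma integral_fourier_char: "integral {0..1} (fourier_char n) = (if n = 0 then 1 else 0)"
proof (cases "n = 0")
  case False
  have "(fourier_char n has_integral fourier_char n 1 / (2 * pi * \<i> * of_int n) - fourier_char n 0 / (2 * pi * \<i> * of_int n)) {0..1}"
  proof (rule fundamental_theorem_of_calculus)
    fix t :: real
    have "((\<lambda>w. exp (2 * pi * \<i> * of_int n * w) / (2 * pi * \<i> * of_int n)) has_field_derivative fourier_char n t) (at (of_real t))"
      using False by (auto simp: fourier_char_def intro!: derivative_eq_intros)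
    then show "((\<lambda>t. fourier_char n t / (2 * pi * \<i> * of_int n)) has_vector_derivative fourier_char n t) (at t within {0..1})"
      unfolding fourier_char_def by (rule has_vector_derivative_real_field)
  qed simp
  moreover have "fourier_char n 1 = 1" "fourier_char n 0 = 1"
    using exp_two_pi_of_int[of n] by (simp_all add: fourier_char_def)
  ultimately show ?thesis using False by (simp add: integral_unique)
qed (simp add: fourier_char_def[abs_def])

text \<open>Termwise integration leaves only n = 0: along the finite sets of indices the integral
  equals 1 as soon as 0 is included. The value serves to determine the constant in
  \<open>jac_inversion\<close> and to show that it is not 0.\<close>

lemma integral_jac:
  assumes "Im \<tau> > 0"
  shows "integral {0..1} (\<lambda>t. jac \<tau> (of_real t)) = 1"
proof -
  let ?f = "\<lambda>(n::int) t::real. exp (pi * \<i> * of_int n ^ 2 * \<tau>) * fourier_char n t"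
  let ?M = "\<lambda>n::int. exp (2 * pi * 1 * \<bar>of_int n\<bar> - pi * Im \<tau> * (of_int n)\<^sup>2)"
  have jac: "jac \<tau> (of_real t) = (\<Sum>\<^sub>\<infinity>n. ?f n t)" for t
    by (simp add: jac_def fourier_char_def exp_add)
  have ul: "uniform_limit {0..1} (\<lambda>X t. \<Sum>n\<in>X. ?f n t) (\<lambda>t. \<Sum>\<^sub>\<infinity>n. ?f n t) (finite_subsets_at_top UNIV)"
  proof (rule Weierstrass_m_test_general)
    show "?M summable_on UNIV" using assms by (intro summable_on_int_exp) auto
    show "norm (?f n t) \<le> ?M n" if "t \<in> {0..1}" for n t
      using norm_jac_term_le[of "of_real t" 1 n \<tau>] that unfolding fourier_char_def exp_add[symmetric] by simp
  qed
  have cont: "continuous_on {0..1} (\<lambda>t. \<Sum>n\<in>X. ?f n t)" for X by (intro continuous_intros)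
  obtain I J where I: "\<And>X. ((\<lambda>t. \<Sum>n\<in>X. ?f n t) has_integral I X) {0..1}"
    and J: "((\<lambda>t. \<Sum>\<^sub>\<infinity>n. ?f n t) has_integral J) {0..1}" and lim: "(I \<longlongrightarrow> J) (finite_subsets_at_top UNIV)"
    using uniform_limit_integral[OF ul cont finite_subsets_at_top_neq_bot] by blast
  have "I X = 1" if "finite X" "{0} \<subseteq> X" for X
  proof -
    have "I X = integral {0..1} (\<lambda>t. \<Sum>n\<in>X. ?f n t)" by (rule integral_unique[symmetric, OF I])
    also have "\<dots> = (\<Sum>n\<in>X. integral {0..1} (?f n))"
      using \<open>finite X\<close> by (intro integral_sum integrable_continuous_real continuous_intros) auto
    also have "\<dots> = (\<Sum>n\<in>X. if n = 0 then 1 else 0)"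
      by (rule sum.cong) (auto simp: integral_fourier_char)
    also have "\<dots> = 1" using that by simp
    finally show ?thesis .
  qed
  then have "eventually (\<lambda>X. I X = 1) (finite_subsets_at_top UNIV)"
    unfolding eventually_finite_subsets_at_top by (intro exI[of _ "{0}"]) auto
  then have "(I \<longlongrightarrow> 1) (finite_subsets_at_top UNIV)" by (rule tendsto_eventually)
  then have "J = 1" using tendsto_unique[OF finite_subsets_at_top_neq_bot lim] by blast
  then show ?thesis using J unfolding jac by (simp add: integral_unique)
qed

text \<open>Shifting the path of integration by \<open>\<tau>\<close> makes consecutive Fourier coefficients proportional,
  so the vanishing of one of them forces all of them to vanish.\<close>

lemma theta_space_eq_0:
  assumes f: "f holomorphic_on UNIV" and per: "\<And>z. f (z + 1) = f z"
    and quasi: "\<And>z. f (z + \<tau>) = exp (- (pi * \<i> * \<tau>) - 2 * pi * \<i> * z) * f z"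
    and null: "integral {0..1} (\<lambda>t. f (of_real t)) = 0"
  shows "f z = 0"
proof (rule periodic_entire_eq_0[OF f per])
  let ?c = "\<lambda>k. integral {0..1} (\<lambda>t. f (of_real t) * fourier_char k t)"
  have step: "?c k = exp (2 * pi * \<i> * of_int k * \<tau> - pi * \<i> * \<tau>) * ?c (k - 1)" for k
  proof -
    let ?g = "\<lambda>z. f z * exp (2 * pi * \<i> * of_int k * z)"
    have "?g holomorphic_on UNIV" by (intro holomorphic_intros f)
    moreover have "?g (z + 1) = ?g z" for z
      using exp_two_pi_of_int[of k] by (simp add: per distrib_left exp_add)
    ultimately have "integral {0..1} (\<lambda>t. ?g (\<tau> + of_real t)) = integral {0..1} (\<lambda>t. ?g (of_real t))"
      by (rule periodic_integral_shift)
    moreover have "?g (\<tau> + of_real t) = exp (2 * pi * \<i> * of_int k * \<tau> - pi * \<i> * \<tau>) * (f (of_real t) * fourier_char (k - 1) t)" for t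
      using quasi[of "of_real t"]
      by (simp add: add.commute fourier_char_def exp_add[symmetric] mult.assoc mult.left_commute[of _ "f _"])
         (simp add: algebra_simps)
    ultimately show ?thesis by (simp add: fourier_char_def)
  qed
  have iff: "?c k = 0 \<longleftrightarrow> ?c (k - 1) = 0" for k unfolding step[of k] by simp
  have "?c 0 = 0" using null by (simp add: fourier_char_def)
  then show "?c k = 0" for k
  proof (induction k rule: int_induct[of _ 0])
    case (step1 i)
    then show ?case using iff[of "i + 1"] by simp
  next
    case (step2 i)
    then show ?case using iff[of i] by simp
  qed
qed

lemma Im_minus_inverse: "Im (- 1 / \<tau>) = Im \<tau> / (cmod \<tau>)\<^sup>2"
  by (simp add: Im_divide cmod_power2)

text \<open>Both sides lie in the space of entire functions with the multipliers of \<open>jac (- 1 / \<tau>)\<close>,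
  which is one-dimensional; the value of \<open>c\<close> is never needed.\<close>

lemma jac_inversion:
  assumes \<tau>: "Im \<tau> > 0"
  shows "\<exists>c. c \<noteq> 0 \<and> (\<forall>z. exp (pi * \<i> * \<tau> * z\<^sup>2) * jac \<tau> (\<tau> * z) = c * jac (- 1 / \<tau>) z)"
proof -
  let ?E = "\<lambda>z. exp (pi * \<i> * \<tau> * z\<^sup>2) * jac \<tau> (\<tau> * z)"
  let ?s = "- 1 / \<tau>"
  have nz: "\<tau> \<noteq> 0" using \<tau> by auto
  have s: "Im ?s > 0" using \<tau> nz by (simp only: Im_minus_inverse) simp
  define c where "c = integral {0..1} (\<lambda>t. ?E (of_real t))"
  have holE: "?E holomorphic_on UNIV"
  proof -
    have "(jac \<tau> \<circ> (\<lambda>z. \<tau> * z)) holomorphic_on UNIV"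
      by (rule holomorphic_on_compose_gen[OF _ jac_holomorphic[OF \<tau>]]) (auto intro: holomorphic_intros)
    then show ?thesis unfolding o_def by (intro holomorphic_intros)
  qed
  have eq: "?E z - c * jac ?s z = 0" for z
  proof (rule theta_space_eq_0[where \<tau> = ?s and f = "\<lambda>z. ?E z - c * jac ?s z"])
    show "(\<lambda>z. ?E z - c * jac ?s z) holomorphic_on UNIV"
      by (intro holomorphic_intros holE jac_holomorphic[OF s])
    \<comment> \<open>Replacing z by z + 1 moves the argument of \<open>jac \<tau>\<close> by
      \<tau>; the Gaussian factor is chosen to cancel the resulting multiplier.\<close>
    have E1: "?E (z + 1) = ?E z" for z
    proof -
      have "?E (z + 1) = exp (pi * \<i> * \<tau> * (z + 1)\<^sup>2) * (exp (- (pi * \<i> * \<tau>) - 2 * pi * \<i> * (\<tau> * z)) * jac \<tau> (\<tau> * z))"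
        using jac_plus_tau[of \<tau> "\<tau> * z"] by (simp add: distrib_left)
      also have "\<dots> = ?E z"
        by (simp only: mult.assoc[symmetric] exp_add[symmetric]) (simp add: power2_eq_square algebra_simps)
      finally show ?thesis .
    qed
    then show "?E (z + 1) - c * jac ?s (z + 1) = ?E z - c * jac ?s z" for z
      by (simp only: jac_plus_one)
    \<comment> \<open>Now the argument of \<open>jac \<tau>\<close> moves by -1, and the multiplier
      comes from the Gaussian factor alone.\<close>
    have E2: "?E (z + ?s) = exp (- (pi * \<i> * ?s) - 2 * pi * \<i> * z) * ?E z" for z
    proof -
      have "\<tau> * (z + ?s) + 1 = \<tau> * z" using nz by (simp add: field_simps)
      then have "jac \<tau> (\<tau> * (z + ?s)) = jac \<tau> (\<tau> * z)" by (metis jac_plus_one)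
      moreover have "\<tau> * (z + ?s)\<^sup>2 = \<tau> * z\<^sup>2 - 2 * z - ?s"
        using nz by (simp add: power2_eq_square field_simps)
      then have "exp (pi * \<i> * \<tau> * (z + ?s)\<^sup>2) = exp (- (pi * \<i> * ?s) - 2 * pi * \<i> * z) * exp (pi * \<i> * \<tau> * z\<^sup>2)"
        by (simp only: mult.assoc exp_add[symmetric]) (simp add: algebra_simps)
      ultimately show ?thesis by simp
    qed
    show "?E (z + ?s) - c * jac ?s (z + ?s) = exp (- (pi * \<i> * ?s) - 2 * pi * \<i> * z) * (?E z - c * jac ?s z)" for z
      by (simp only: E2 jac_plus_tau[of ?s]) (simp add: algebra_simps)
    have "continuous_on {0..1} (\<lambda>t::real. ?E (of_real t))"
      by (rule continuous_on_compose2[OF holomorphic_on_imp_continuous_on[OF holE]]) (auto intro!: continuous_intros)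
    moreover have "continuous_on {0..1} (\<lambda>t::real. c * jac ?s (of_real t))"
      by (intro continuous_intros continuous_on_compose2[OF holomorphic_on_imp_continuous_on[OF jac_holomorphic[OF s]]]) auto
    ultimately have "(\<lambda>t::real. ?E (of_real t)) integrable_on {0..1}" "(\<lambda>t::real. c * jac ?s (of_real t)) integrable_on {0..1}"
      by (blast intro: integrable_continuous_real)+
    from integral_diff[OF this]
    show "integral {0..1} (\<lambda>t. ?E (of_real t) - c * jac ?s (of_real t)) = 0"
      using integral_jac[OF s] by (simp add: c_def)
  qed
  moreover have "c \<noteq> 0"
  proof
    assume "c = 0"
    with eq have "jac \<tau> (\<tau> * z) = 0" for z by simp
    from this[of "z / \<tau>" for z] have "jac \<tau> z = 0" for z using nz by simp
    then show False using integral_jac[OF \<tau>] by simp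
  qed
  ultimately show ?thesis by auto
qed

section \<open>Transformation of theta constants\<close>

lemma theta_const_eq_jac:
  fixes e e' :: real and \<tau> :: complex
  shows
  "theta_const e e' \<tau> = exp (pi * \<i> * e\<^sup>2 * \<tau> / 4 + pi * \<i> * e * e' / 2) * jac \<tau> ((e * \<tau> + e') / 2)"
  unfolding theta_const_def jac_def
  by (subst infsum_cmult_right'[symmetric], rule infsum_cong)
     (simp only: exp_add[symmetric], rule arg_cong[where f = exp], simp add: power2_eq_square field_simps)

lemma theta_const_shift1:
  fixes e e' :: real and \<tau> :: complex
  shows "theta_const (e + 2 * of_int m) e' \<tau> = theta_const e e' \<tau>"
proof -
  have "bij (\<lambda>n::int. n + m)" by (auto intro!: bij_betwI[where g="\<lambda>n. n - m"])
  from infsum_reindex_bij_betw[OF this, of "\<lambda>n. exp (2 * complex_of_real pi * \<i> *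
        ((complex_of_real ((of_int n + e / 2)^2) / 2) * \<tau>
         + complex_of_real ((of_int n + e / 2) * (e' / 2))))"]
  show ?thesis unfolding theta_const_def by (simp add: add_divide_distrib ac_simps)
qed

lemma theta_const_shift2:
  fixes e e' :: real and \<tau> :: complex
  shows "theta_const e (e' + 2 * of_int m) \<tau> = exp (pi * \<i> * e * of_int m) * theta_const e e' \<tau>"
  unfolding theta_const_def
proof (subst infsum_cmult_right'[symmetric], rule infsum_cong)
  fix n :: int
  let ?a = "2 * complex_of_real pi * \<i> * ((complex_of_real ((of_int n + e / 2)^2) / 2) * \<tau>
         + complex_of_real ((of_int n + e / 2) * (e' / 2)))"
  have "2 * complex_of_real pi * \<i> * ((complex_of_real ((of_int n + e / 2)^2) / 2) * \<tau>
         + complex_of_real ((of_int n + e / 2) * ((e' + 2 * of_int m) / 2)))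
        = pi * \<i> * e * of_int m + ?a + 2 * complex_of_real pi * \<i> * of_int (n * m)"
    by (simp add: field_simps)
  then show "exp (2 * complex_of_real pi * \<i> * ((complex_of_real ((of_int n + e / 2)^2) / 2) * \<tau>
         + complex_of_real ((of_int n + e / 2) * ((e' + 2 * of_int m) / 2))))
        = exp (pi * \<i> * e * of_int m) * exp ?a"
    by (simp only: exp_add exp_two_pi_of_int mult_1_right)
qed

text \<open>As n^2 and n have the same parity, the phase exp(pi i (n + e/2)^2) agrees with one that
  is linear in n up to a constant. It is absorbed by the second characteristic; replacing n^2 by n
  is the origin of the summand 1.\<close>

lemma theta_const_plus_one:
  fixes e e' :: real and \<tau> :: complex
  shows
  "theta_const e e' (\<tau> + 1) = exp (- (pi * \<i> * (e / 2 + e\<^sup>2 / 4))) * theta_const e (e' + e + 1) \<tau>"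
  unfolding theta_const_def
proof (subst infsum_cmult_right'[symmetric], rule infsum_cong)
  fix n :: int
  let ?a = "2 * complex_of_real pi * \<i> * ((complex_of_real ((of_int n + e / 2)^2) / 2) * \<tau>
         + complex_of_real ((of_int n + e / 2) * ((e' + e + 1) / 2)))"
  have "even (n * n - n)" by simp
  then obtain m where m: "n * n - n = 2 * m" by blast
  have m': "complex_of_int n * of_int n = of_int n + 2 * of_int m"
    using arg_cong[OF m, of complex_of_int] by (simp add: algebra_simps)
  have "2 * complex_of_real pi * \<i> * ((complex_of_real ((of_int n + e / 2)^2) / 2) * (\<tau> + 1)
         + complex_of_real ((of_int n + e / 2) * (e' / 2)))
        = - (pi * \<i> * (e / 2 + e\<^sup>2 / 4)) + ?a + pi * \<i> * (complex_of_int n * of_int n - of_int n)"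
    by (simp add: field_simps power2_eq_square)
  also have "\<dots> = - (pi * \<i> * (e / 2 + e\<^sup>2 / 4)) + ?a + 2 * complex_of_real pi * \<i> * of_int m"
    unfolding m' by simp
  finally show "exp (2 * complex_of_real pi * \<i> * ((complex_of_real ((of_int n + e / 2)^2) / 2) * (\<tau> + 1)
         + complex_of_real ((of_int n + e / 2) * (e' / 2))))
        = exp (- (pi * \<i> * (e / 2 + e\<^sup>2 / 4))) * exp ?a"
    by (simp only: exp_add exp_two_pi_of_int mult_1_right)
qed

text \<open>The constant precedes the quantifier over characteristics: it depends on \<tau> alone
  and is the common automorphy factor. For z = (- e / \<tau> + e') / 2 one has \<tau> z = (e' \<tau>
  - e) / 2, which exchanges the characteristics.\<close>

lemma theta_const_inversion:
  fixes \<tau> :: complex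
  assumes "Im \<tau> > 0"
  shows "\<exists>c. c \<noteq> 0 \<and> (\<forall>e e' :: real. theta_const e e' (- 1 / \<tau>) = c * exp (pi * \<i> * e * e' / 2) * theta_const e' (- e) \<tau>)"
proof -
  have nz: "\<tau> \<noteq> 0" using assms by auto
  obtain c where c: "c \<noteq> 0" "\<And>z. exp (pi * \<i> * \<tau> * z\<^sup>2) * jac \<tau> (\<tau> * z) = c * jac (- 1 / \<tau>) z"
    using jac_inversion[OF assms] by blast
  have cancel: "inverse c * (c * x) = x" for x using c(1) by (simp add: field_simps)
  have "theta_const e e' (- 1 / \<tau>) = inverse c * exp (pi * \<i> * e * e' / 2) * theta_const e' (- e) \<tau>" for e e' :: real
  proof -
    let ?z = "(e * (- 1 / \<tau>) + e') / 2"
    have z: "\<tau> * ?z = (e' * \<tau> + of_real (- e)) / 2" using nz by (simp add: field_simps)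
    have "theta_const e e' (- 1 / \<tau>) = exp (pi * \<i> * e\<^sup>2 * (- 1 / \<tau>) / 4 + pi * \<i> * e * e' / 2) * (inverse c * (c * jac (- 1 / \<tau>) ?z))"
      by (subst theta_const_eq_jac) (simp only: cancel of_real_power)
    also have "\<dots> = inverse c * (exp (pi * \<i> * e\<^sup>2 * (- 1 / \<tau>) / 4 + pi * \<i> * e * e' / 2 + pi * \<i> * \<tau> * ?z\<^sup>2) * jac \<tau> (\<tau> * ?z))"
      unfolding c(2)[symmetric] exp_add by simp
    also have "pi * \<i> * e\<^sup>2 * (- 1 / \<tau>) / 4 + pi * \<i> * e * e' / 2 + pi * \<i> * \<tau> * ?z\<^sup>2
      = pi * \<i> * e * e' / 2 + (pi * \<i> * e'\<^sup>2 * \<tau> / 4 + pi * \<i> * e' * of_real (- e) / 2)"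
      using nz by (simp add: field_simps power2_eq_square)
    finally show ?thesis unfolding z exp_add[of "pi * \<i> * e * e' / 2"] theta_const_eq_jac
      by (simp only: mult.assoc of_real_power)
  qed
  then show ?thesis using c(1) by (intro exI[of _ "inverse c"]) auto
qed

definition theta_family :: "(complex \<Rightarrow> complex) set" where
  "theta_family = {\<lambda>\<tau>. u * theta_const (of_int j / 5) (of_int k / 5) \<tau> | u j k. u ^ 200 = 1}"

lemma theta_familyI:
  assumes "u ^ 200 = 1" "\<And>\<tau>. h \<tau> = u * theta_const (of_int j / 5) (of_int k / 5) \<tau>"
  shows "h \<in> theta_family"
proof -
  have "h = (\<lambda>\<tau>. u * theta_const (of_int j / 5) (of_int k / 5) \<tau>)" using assms(2) by (rule ext)
  then show ?thesis using assms(1) unfolding theta_family_def by blast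
qed

lemma theta_familyE:
  assumes "h \<in> theta_family"
  obtains u j k where "u ^ 200 = 1" "h = (\<lambda>\<tau>. u * theta_const (of_int j / 5) (of_int k / 5) \<tau>)"
  using assms unfolding theta_family_def by blast

definition root200 :: "int \<Rightarrow> complex" where
  "root200 m = exp (2 * pi * \<i> * of_int m / 200)"

lemma root200_power: "root200 m ^ 200 = 1"
proof -
  have "root200 m ^ 200 = exp (2 * complex_of_real pi * \<i> * of_int m)"
    unfolding root200_def exp_of_nat_mult[symmetric] by (rule arg_cong[where f = exp]) simp
  then show ?thesis by (simp only: exp_two_pi_of_int)
qed

lemma root200_minus: "root200 (- m) * root200 m = 1"
  by (simp add: root200_def exp_add[symmetric])

lemma root200_mult_power:
  assumes "u ^ 200 = 1"
  shows "(u * root200 m) ^ 200 = 1"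
  using assms by (simp add: power_mult_distrib root200_power)

text \<open>Up to a root of unity from \<open>theta_const_shift2\<close> the characteristics count
  only modulo 2, hence the indices only modulo 10.\<close>

lemma finite_theta_family: "finite theta_family"
proof (rule finite_subset)
  let ?F = "\<lambda>(u, j, k) \<tau>. u * theta_const (of_int j / 5) (of_int k / 5) \<tau>"
  show "theta_family \<subseteq> ?F ` ({u. u ^ 200 = 1} \<times> {0..<10} \<times> {0..<10})"
  proof
    fix h assume "h \<in> theta_family"
    then obtain u j k where u: "u ^ 200 = 1"
      and h: "h = (\<lambda>\<tau>. u * theta_const (of_int j / 5) (of_int k / 5) \<tau>)" by (rule theta_familyE)
    define j' k' where "j' = j mod 10" and "k' = k mod 10"
    have "j = j' + 10 * (j div 10)" "k = k' + 10 * (k div 10)" by (simp_all add: j'_def k'_def)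
    from this[THEN arg_cong, of real_of_int]
    have j: "real_of_int j / 5 = of_int j' / 5 + 2 * of_int (j div 10)"
      and k: "real_of_int k / 5 = of_int k' / 5 + 2 * of_int (k div 10)" by simp_all
    have "exp (pi * \<i> * complex_of_real (of_int j' / 5) * of_int (k div 10)) = root200 (20 * j' * (k div 10))"
      unfolding root200_def by (rule arg_cong[where f = exp]) (simp add: field_simps)
    then have "theta_const (of_int j / 5) (of_int k / 5) \<tau> = root200 (20 * j' * (k div 10)) * theta_const (of_int j' / 5) (of_int k' / 5) \<tau>" for \<tau>
      using theta_const_shift1[of "of_int j' / 5" "j div 10" "of_int k' / 5 + 2 * of_int (k div 10)" \<tau>]
        theta_const_shift2[of "of_int j' / 5" "of_int k' / 5" "k div 10" \<tau>]
      unfolding j k by simp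
    then have "h = ?F (u * root200 (20 * j' * (k div 10)), j', k')"
      unfolding h by (simp add: mult.assoc)
    moreover have "(u * root200 (20 * j' * (k div 10)), j', k') \<in> {u. u ^ 200 = 1} \<times> {0..<10} \<times> {0..<10}"
      using root200_mult_power[OF u] by (simp add: j'_def k'_def)
    ultimately show "h \<in> ?F ` ({u. u ^ 200 = 1} \<times> {0..<10} \<times> {0..<10})" by blast
  qed
  show "finite (?F ` ({u. u ^ 200 = 1} \<times> {0..<10::int} \<times> {0..<10::int}))"
    using finite_roots_unity[of 200] by (intro finite_imageI finite_cartesian_product) auto
qed

text \<open>\<open>form_bounded_transfer\<close> needs both directions, one to compare the maxima
  and the other to compare the values on triples.\<close>

lemma theta_family_plus_one:
  assumes "h \<in> theta_family"
  shows "\<exists>h'\<in>theta_family. \<forall>\<tau>. h (\<tau> + 1) = h' \<tau>" "\<exists>h'\<in>theta_family. \<forall>\<tau>. h \<tau> = h' (\<tau> + 1)"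
proof -
  obtain u j k where u: "u ^ 200 = 1"
    and h: "h = (\<lambda>\<tau>. u * theta_const (of_int j / 5) (of_int k / 5) \<tau>)" using assms by (rule theta_familyE)
  \<comment> \<open>The phase of \<open>theta_const_plus_one\<close> at e = j / 5, as an exponent
    for \<open>root200\<close>. In units of 1/5 the second characteristic moves by j + 5.\<close>
  define m where "m = - (10 * j + j * j)"
  have T: "theta_const (of_int j / 5) (of_int k / 5) (\<tau> + 1) = root200 m * theta_const (of_int j / 5) (of_int (k + j + 5) / 5) \<tau>"
    for k \<tau>
  proof -
    have e1: "exp (- (pi * \<i> * complex_of_real (real_of_int j / 5 / 2 + (real_of_int j / 5)\<^sup>2 / 4))) = root200 m"
      unfolding root200_def m_def by (rule arg_cong[where f = exp]) (simp add: field_simps power2_eq_square)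
    have e2: "real_of_int k / 5 + of_int j / 5 + 1 = of_int (k + j + 5) / 5" by simp
    show ?thesis
      using theta_const_plus_one[of "of_int j / 5" "of_int k / 5" \<tau>] unfolding e1 e2 .
  qed
  show "\<exists>h'\<in>theta_family. \<forall>\<tau>. h (\<tau> + 1) = h' \<tau>"
  proof (intro bexI allI)
    let ?h = "\<lambda>\<tau>. u * root200 m * theta_const (of_int j / 5) (of_int (k + j + 5) / 5) \<tau>"
    show "h (\<tau> + 1) = ?h \<tau>" for \<tau> unfolding h T by (simp only: mult.assoc)
    show "?h \<in> theta_family" by (rule theta_familyI[OF root200_mult_power[OF u] refl])
  qed
  show "\<exists>h'\<in>theta_family. \<forall>\<tau>. h \<tau> = h' (\<tau> + 1)"
  proof (intro bexI allI)
    let ?h = "\<lambda>\<tau>. u * root200 (- m) * theta_const (of_int j / 5) (of_int (k - j - 5) / 5) \<tau>"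
    have "?h (\<tau> + 1) = (root200 (- m) * root200 m) * (u * theta_const (of_int j / 5) (of_int (k - j - 5 + j + 5) / 5) \<tau>)" for \<tau>
      unfolding T by (simp only: ac_simps)
    then have "?h (\<tau> + 1) = h \<tau>" for \<tau> unfolding root200_minus h by simp
    then show "h \<tau> = ?h (\<tau> + 1)" for \<tau> by (rule sym)
    show "?h \<in> theta_family" by (rule theta_familyI[OF root200_mult_power[OF u] refl])
  qed
qed

lemma theta_family_inversion:
  assumes "Im \<tau> > 0"
  shows "\<exists>c. c \<noteq> 0 \<and> (\<forall>h\<in>theta_family. \<exists>h'\<in>theta_family. h (- 1 / \<tau>) = c * h' \<tau>)
    \<and> (\<forall>h\<in>theta_family. \<exists>h'\<in>theta_family. c * h \<tau> = h' (- 1 / \<tau>))"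
proof -
  obtain c where c: "c \<noteq> 0" and S: "\<And>e e' :: real. theta_const e e' (- 1 / \<tau>) = c * exp (pi * \<i> * e * e' / 2) * theta_const e' (- e) \<tau>"
    using theta_const_inversion[OF assms] by blast
  have S: "theta_const (of_int j / 5) (of_int k / 5) (- 1 / \<tau>) = c * root200 (2 * j * k) * theta_const (of_int k / 5) (of_int (- j) / 5) \<tau>" for j k
  proof -
    have "exp (pi * \<i> * complex_of_real (of_int j / 5) * complex_of_real (of_int k / 5) / 2) = root200 (2 * j * k)"
      unfolding root200_def by (rule arg_cong[where f = exp]) (simp add: field_simps)
    then show ?thesis using S[of "of_int j / 5" "of_int k / 5"] by simp
  qed
  show ?thesis
  proof (intro exI[of _ c] conjI ballI)
    fix h assume "h \<in> theta_family"
    then obtain u j k where u: "u ^ 200 = 1"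
      and h: "h = (\<lambda>\<tau>. u * theta_const (of_int j / 5) (of_int k / 5) \<tau>)" by (rule theta_familyE)
    show "\<exists>h'\<in>theta_family. h (- 1 / \<tau>) = c * h' \<tau>"
    proof
      let ?h = "\<lambda>\<tau>. u * root200 (2 * j * k) * theta_const (of_int k / 5) (of_int (- j) / 5) \<tau>"
      show "?h \<in> theta_family" by (rule theta_familyI[OF root200_mult_power[OF u] refl])
      show "h (- 1 / \<tau>) = c * ?h \<tau>" unfolding h S by (simp only: ac_simps)
    qed
    show "\<exists>h'\<in>theta_family. c * h \<tau> = h' (- 1 / \<tau>)"
    proof
      \<comment> \<open>Inversion sends the index pair (a, b) to (b, - a), so (- k, j) is the
        preimage of (j, k).\<close>
      let ?h = "\<lambda>\<tau>. u * root200 (- (2 * (- k) * j)) * theta_const (of_int (- k) / 5) (of_int j / 5) \<tau>"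
      show "?h \<in> theta_family" by (rule theta_familyI[OF root200_mult_power[OF u] refl])
      have "?h (- 1 / \<tau>) = (root200 (- (2 * (- k) * j)) * root200 (2 * (- k) * j)) * (c * (u * theta_const (of_int j / 5) (of_int (- (- k)) / 5) \<tau>))"
        unfolding S by (simp only: ac_simps)
      then have "?h (- 1 / \<tau>) = c * h \<tau>" unfolding root200_minus h by simp
      then show "c * h \<tau> = ?h (- 1 / \<tau>)" by (rule sym)
    qed
  qed (rule c)
qed

text \<open>The variable exp(pi i \<tau> / 100) clears the denominators of (n + j/10)^2 for all j at
  once: the exponents become (10 n + j)^2. Holomorphy of g at 0 is regularity at the cusp. The
  identity is termwise and so holds for every \<tau>.\<close>

lemma theta_const_q_expansion:
  fixes j k :: int
  obtains g where "g holomorphic_on ball 0 1"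
    "\<And>\<tau>. theta_const (of_int j / 5) (of_int k / 5) \<tau> = g (exp (pi * \<i> * \<tau> / 100))"
proof
  define c where "c n = exp (pi * \<i> * (of_int n + of_int j / 10) * of_int k / 5)" for n :: int
  define e where "e n = nat ((10 * n + j)\<^sup>2)" for n
  let ?g = "\<lambda>w. \<Sum>\<^sub>\<infinity>n. c n * w ^ e n"
  show "theta_const (of_int j / 5) (of_int k / 5) \<tau> = ?g (exp (pi * \<i> * \<tau> / 100))" for \<tau>
    unfolding theta_const_def
  proof (rule infsum_cong)
    fix n :: int
    have e: "of_nat (e n) = (10 * complex_of_int n + of_int j)\<^sup>2"
      by (simp add: e_def of_nat_nat)
    show "exp (2 * complex_of_real pi * \<i> * ((complex_of_real ((of_int n + of_int j / 5 / 2)^2) / 2) * \<tau>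
         + complex_of_real ((of_int n + of_int j / 5 / 2) * (of_int k / 5 / 2))))
       = c n * exp (pi * \<i> * \<tau> / 100) ^ e n"
      unfolding c_def exp_of_nat_mult[symmetric] exp_add[symmetric] e
      by (rule arg_cong[where f = exp]) (simp add: field_simps power2_eq_square)
  qed
  show "?g holomorphic_on ball 0 1"
  proof (rule holomorphic_on_infsum)
    fix z :: complex assume "z \<in> ball 0 1"
    then have "cmod z < 1" by simp
    then obtain r where r: "cmod z < r" "r < 1" using dense by blast
    then have r0: "r > 0" using norm_ge_zero[of z] by linarith
    define L where "L = - ln r"
    have L: "L > 0" using r r0 by (simp add: L_def)
    \<comment> \<open>This bounds r^((10 n + j)^2) = exp(- L (10 n + j)^2): the summand j^2 is
      dropped and the cross term 20 n j is estimated by its absolute value.\<close>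
    let ?M = "\<lambda>n::int. exp ((20 * \<bar>of_int j\<bar> * L) * \<bar>of_int n\<bar> - 100 * L * (of_int n)\<^sup>2)"
    show "\<exists>e'>0. \<exists>M. M summable_on UNIV \<and> (\<forall>n\<in>UNIV. \<forall>w\<in>ball z e'. cmod (c n * w ^ e n) \<le> M n)"
    proof (intro exI[of _ "r - cmod z"] exI[of _ ?M] conjI ballI)
      show "?M summable_on UNIV" using L by (intro summable_on_int_exp) auto
      fix n w assume "w \<in> ball z (r - cmod z)"
      then have w: "cmod w \<le> r"
        using norm_triangle_sub[of w z] by (simp add: dist_norm norm_minus_commute)
      have "cmod (c n) = 1" by (simp add: c_def Im_divide_of_real)
      then have "cmod (c n * w ^ e n) = cmod w ^ e n" by (simp add: norm_mult norm_power)
      also have "\<dots> \<le> r ^ e n" using w by (intro power_mono) auto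
      also have "\<dots> = exp (of_nat (e n) * ln r)" using r0 by (simp add: exp_of_nat_mult)
      also have "\<dots> \<le> ?M n"
      proof -
        have "- (20 * (of_int n * of_int j)) \<le> 20 * (\<bar>real_of_int j\<bar> * \<bar>of_int n\<bar>)"
          using abs_ge_minus_self[of "real_of_int n * of_int j"] by (simp add: abs_mult mult.commute)
        moreover have "real (e n) = (10 * of_int n + of_int j)\<^sup>2"
          by (simp add: e_def of_nat_nat)
        then have "real (e n) = 100 * (of_int n)\<^sup>2 + 20 * (of_int n * of_int j) + (of_int j)\<^sup>2"
          by (simp add: power2_eq_square algebra_simps)
        ultimately have "- real (e n) \<le> 20 * (\<bar>of_int j\<bar> * \<bar>of_int n\<bar>) - 100 * (of_int n)\<^sup>2"
          using zero_le_power2[of "real_of_int j"] by linarith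
        then have "(- real (e n)) * L \<le> (20 * (\<bar>of_int j\<bar> * \<bar>of_int n\<bar>) - 100 * (of_int n)\<^sup>2) * L"
          using L by (intro mult_right_mono) auto
        then show ?thesis by (simp add: L_def algebra_simps)
      qed
      finally show "cmod (c n * w ^ e n) \<le> ?M n" .
    qed (use r in simp)
  qed (auto intro!: holomorphic_intros)
qed

lemma theta_family_q_expansion:
  assumes "h \<in> theta_family"
  shows "\<exists>g. g holomorphic_on ball 0 1 \<and> (\<forall>\<tau>. h \<tau> = g (exp (pi * \<i> * \<tau> / 100)))"
proof -
  obtain u j k where u: "u ^ 200 = 1"
    and h: "h = (\<lambda>\<tau>. u * theta_const (of_int j / 5) (of_int k / 5) \<tau>)" using assms by (rule theta_familyE)
  obtain g where "g holomorphic_on ball 0 1"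
    "\<And>\<tau>. theta_const (of_int j / 5) (of_int k / 5) \<tau> = g (exp (pi * \<i> * \<tau> / 100))"
    using theta_const_q_expansion[of j k] by blast
  then show ?thesis unfolding h by (intro exI[of _ "\<lambda>w. u * g w"]) (auto intro!: holomorphic_intros)
qed

text \<open>With r = exp(- pi Im \<tau>) and n^2 >= |n|, the terms with n different from 0
  contribute at most 2 r / (1 - r) to the modulus.\<close>

lemma theta_const_0_0_lower_bound:
  assumes "Im \<tau> \<ge> 4 / 5"
  shows "1 / 6 \<le> cmod (theta_const 0 0 \<tau>)"
proof -
  define r where "r = exp (- pi * Im \<tau>)"
  \<comment> \<open>Here 12/5 = 3 * 4/5 is a lower bound for pi Im \<tau>, and 17/5 = 1 + 12/5. Then
    r <= 5/17, and the two tails together are at most 5/6.\<close>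
  have "17 / 5 \<le> exp (12 / 5 :: real)" using exp_ge_add_one_self[of "12/5::real"] by simp
  also have "12 / 5 \<le> pi * Im \<tau>" using mult_mono[of 3 pi "4/5" "Im \<tau>"] pi_gt3 assms by simp
  finally have "17 / 5 \<le> exp (pi * Im \<tau>)" by simp
  then have r: "r \<le> 5 / 17" "r > 0" by (simp_all add: r_def exp_minus field_simps)
  let ?f = "\<lambda>n::int. exp (pi * \<i> * of_int n ^ 2 * \<tau> + 2 * pi * \<i> * of_int n * 0)"
  have sm: "?f summable_on A" for A
    by (rule summable_on_subset_banach[OF jac_term_summable]) (use assms in auto)
  have geo: "((\<lambda>n. r ^ n) has_sum r / (1 - r)) {1..}"
    using r by (intro has_sum_geometric_from_1) auto
  have le: "cmod (?f n) \<le> r ^ nat \<bar>n\<bar>" for n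
  proof -
    have "\<bar>n\<bar> \<le> n\<^sup>2" using self_le_power[of "\<bar>n\<bar>" 2] by (cases "n = 0") auto
    then have "real_of_int \<bar>n\<bar> \<le> (of_int n)\<^sup>2" by (metis of_int_le_iff of_int_power)
    then have "real (nat \<bar>n\<bar>) * (pi * Im \<tau>) \<le> (of_int n)\<^sup>2 * (pi * Im \<tau>)"
      using assms by (intro mult_right_mono) auto
    then show ?thesis
      unfolding r_def exp_of_nat_mult[symmetric] by (simp add: power2_eq_square algebra_simps)
  qed
  have bij: "bij_betw int {1..} {1..}" "bij_betw (\<lambda>n. - int n) {1..} {..-1}"
    by (rule bij_betwI[where g = nat], auto) (rule bij_betwI[where g = "\<lambda>n. nat (- n)"], auto)
  have "((\<lambda>n. r ^ nat \<bar>n\<bar>) has_sum r / (1 - r)) {1..}" "((\<lambda>n. r ^ nat \<bar>n\<bar>) has_sum r / (1 - r)) {..-1}"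
    using has_sum_reindex_bij_betw[OF bij(1), of "\<lambda>n. r ^ nat \<bar>n\<bar>"] has_sum_reindex_bij_betw[OF bij(2), of "\<lambda>n. r ^ nat \<bar>n\<bar>"] geo
    by simp_all
  then have b: "cmod (infsum ?f {1..}) \<le> r / (1 - r)" "cmod (infsum ?f {..-1}) \<le> r / (1 - r)"
    using norm_infsum_le[OF has_sum_infsum[OF sm]] le by blast+
  have "infsum ?f UNIV = infsum ?f ({0} \<union> ({1..} \<union> {..-1}))"
    by (rule arg_cong[where f = "infsum ?f"]) auto
  also have "\<dots> = 1 + (infsum ?f {1..} + infsum ?f {..-1})"
    using sm by (subst infsum_Un_disjoint; (subst infsum_Un_disjoint)?) auto
  finally have eq: "theta_const 0 0 \<tau> = 1 + (infsum ?f {1..} + infsum ?f {..-1})"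
    by (simp add: theta_const_eq_jac jac_def)
  have "cmod (infsum ?f {1..} + infsum ?f {..-1}) \<le> r / (1 - r) + r / (1 - r)"
    using b norm_triangle_le by (meson add_mono order_trans norm_triangle_ineq)
  moreover have "r / (1 - r) \<le> 5 / 12" using r by (simp add: pos_divide_le_eq)
  then have "r / (1 - r) + r / (1 - r) \<le> 5 / 6" by linarith
  ultimately show ?thesis
    using norm_diff_ineq[of 1 "infsum ?f {1..} + infsum ?f {..-1}"] unfolding eq norm_one by linarith
qed

section \<open>Linear algebra, vanishing order and reduction\<close>

text \<open>Gaussian elimination, one equation at a time: a pivot unknown p of equation j is
  eliminated from the others and recovered at the end by back substitution.\<close>

lemma homogeneous_system_solution:
  fixes a :: "'j \<Rightarrow> 'i \<Rightarrow> 'c::field"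
  assumes "finite J" "finite I" "card J < card I"
  shows "\<exists>x. (\<exists>i\<in>I. x i \<noteq> 0) \<and> (\<forall>j\<in>J. (\<Sum>i\<in>I. a j i * x i) = 0)"
  using assms
proof (induction J arbitrary: I a rule: finite_induct)
  case empty
  then show ?case by (intro exI[of _ "\<lambda>_. 1"]) (auto simp: card_gt_0_iff)
next
  case (insert j J)
  show ?case
  proof (cases "\<forall>i\<in>I. a j i = 0")
    case True
    from insert obtain x where "\<exists>i\<in>I. x i \<noteq> 0" "\<forall>j\<in>J. (\<Sum>i\<in>I. a j i * x i) = 0"
      by (metis Suc_lessD card_insert_disjoint)
    with True show ?thesis by (intro exI[of _ x]) auto
  next
    case False
    then obtain p where p: "p \<in> I" "a j p \<noteq> 0" by blast
    define b where "b k i = a k i - a k p * a j i / a j p" for k i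
    have "card J < card (I - {p})" using insert p(1) by simp
    from insert.IH[OF _ this, of b] insert.prems obtain x where x: "\<exists>i\<in>I - {p}. x i \<noteq> 0"
      "\<forall>k\<in>J. (\<Sum>i\<in>I - {p}. b k i * x i) = 0" by auto
    define s where "s = (\<Sum>i\<in>I - {p}. a j i * x i)"
    define y where "y = x(p := - s / a j p)"
    have y: "(\<Sum>i\<in>I. a k i * y i) = a k p * (- s / a j p) + (\<Sum>i\<in>I - {p}. a k i * x i)" for k
      using insert.prems(1) p(1) by (subst sum.remove[of I p]) (auto simp: y_def intro!: sum.cong)
    have "(\<Sum>i\<in>I. a j i * y i) = 0" using p(2) by (simp add: y s_def)
    moreover have "(\<Sum>i\<in>I. a k i * y i) = 0" if "k \<in> J" for k
    proof -
      have "0 = (\<Sum>i\<in>I - {p}. a k i * x i - a k p / a j p * (a j i * x i))"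
        using x(2) that by (simp add: b_def left_diff_distrib mult.assoc)
      also have "\<dots> = (\<Sum>i\<in>I - {p}. a k i * x i) - a k p / a j p * s"
        by (simp add: s_def sum_subtractf sum_distrib_left)
      finally show ?thesis by (simp add: y)
    qed
    moreover have "\<exists>i\<in>I. y i \<noteq> 0" using x(1) by (auto simp: y_def)
    ultimately show ?thesis by (intro exI[of _ y]) auto
  qed
qed

text \<open>Schwarz lemma for a zero of order m: the maximum principle is applied to f(z) / z^m. The
  quotient is built as the shifted power series, so that it is holomorphic at 0 as well.\<close>

lemma holomorphic_vanishing_bound:
  assumes hol: "f holomorphic_on ball 0 1"
    and van: "\<And>i. i < m \<Longrightarrow> (deriv ^^ i) f 0 = 0"
    and r: "0 < r" "r < 1" and B: "\<And>z. cmod z = r \<Longrightarrow> cmod (f z) \<le> B"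
    and w: "cmod w \<le> r"
  shows "cmod (f w) \<le> B * (cmod w / r) ^ m"
proof -
  define c where "c n = (deriv ^^ n) f 0 / fact n" for n
  define g where "g z = suminf (\<lambda>n. c (n + m) * z ^ n)" for z
  have f: "(\<lambda>n. c n * z ^ n) sums f z" if "z \<in> ball 0 1" for z
    using holomorphic_power_series[OF hol that] by (simp add: c_def)
  have fg: "f z = z ^ m * g z" and sumg: "(\<lambda>n. c (n + m) * z ^ n) sums g z" if z: "z \<in> ball 0 1" for z
  proof -
    have "(\<lambda>n. c (n + m) * z ^ (n + m)) sums (f z - (\<Sum>i<m. c i * z ^ i))"
      using f[OF z] by (rule sums_split_initial_segment)
    moreover have "(\<Sum>i<m. c i * z ^ i) = 0" using van by (intro sum.neutral) (simp add: c_def)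
    ultimately have s: "(\<lambda>n. z ^ m * (c (n + m) * z ^ n)) sums f z"
      by (simp add: power_add mult_ac)
    show sg: "(\<lambda>n. c (n + m) * z ^ n) sums g z"
    proof (cases "z = 0")
      case True
      then show ?thesis unfolding g_def by (simp add: powser_sums_zero_iff)
    next
      case False
      then have "summable (\<lambda>n. c (n + m) * z ^ n)"
        using sums_summable[OF s] by (subst (asm) summable_cmult_iff) auto
      then show ?thesis unfolding g_def by (rule summable_sums)
    qed
    show "f z = z ^ m * g z" using sums_mult[OF sg, of "z ^ m"] s by (rule sums_unique2[symmetric])
  qed
  have holg: "g holomorphic_on ball 0 1"
    by (rule power_series_holomorphic[where a = "\<lambda>n. c (n + m)"]) (use sumg in simp)
  have "cmod (g w) \<le> B / r ^ m"
  proof (rule maximum_modulus_frontier[of g "cball 0 r" "B / r ^ m" w])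
    show "g holomorphic_on interior (cball 0 r)"
      using r by (intro holomorphic_on_subset[OF holg]) auto
    show "continuous_on (closure (cball 0 r)) g"
      using r by (intro holomorphic_on_imp_continuous_on holomorphic_on_subset[OF holg]) auto
    fix z assume "z \<in> frontier (cball 0 r :: complex set)"
    then have z: "cmod z = r" using r by (simp add: frontier_cball)
    have "cmod (f z) = r ^ m * cmod (g z)" using z r by (subst fg) (auto simp: norm_mult norm_power)
    then show "cmod (g z) \<le> B / r ^ m" using B[OF z] r by (simp add: field_simps)
  qed (use w in auto)
  then have "cmod w ^ m * cmod (g w) \<le> cmod w ^ m * (B / r ^ m)" by (intro mult_left_mono) auto
  then show ?thesis using w r by (subst fg) (auto simp: norm_mult norm_power power_divide mult_ac)
qed

text \<open>Translate to |Re \<sigma>| <= 1/2. If the height is still below 4/5, then |\<sigma>|^2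
  <= 1/4 + 16/25 < 9/10, and inversion raises the height by a factor of at least 10/9.\<close>

lemma modular_reduction:
  fixes Q :: "complex \<Rightarrow> bool"
  assumes T: "\<And>\<tau>. Im \<tau> > 0 \<Longrightarrow> Q (\<tau> + 1) \<longleftrightarrow> Q \<tau>"
    and S: "\<And>\<tau>. Im \<tau> > 0 \<Longrightarrow> Q (- 1 / \<tau>) \<Longrightarrow> Q \<tau>"
    and base: "\<And>\<tau>. Im \<tau> \<ge> 4 / 5 \<Longrightarrow> Q \<tau>"
    and \<tau>: "Im \<tau> > 0"
  shows "Q \<tau>"
proof -
  have Tn: "Q (\<tau> + of_nat n) \<longleftrightarrow> Q \<tau>" if "Im \<tau> > 0" for \<tau> n
  proof (induction n)
    case (Suc n)
    have "Q (\<tau> + of_nat (Suc n)) \<longleftrightarrow> Q (\<tau> + of_nat n + 1)" by (simp add: ac_simps)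
    then show ?case using Suc T[of "\<tau> + of_nat n"] that by simp
  qed simp
  have Tz: "Q (\<tau> + of_int m) \<longleftrightarrow> Q \<tau>" if "Im \<tau> > 0" for \<tau> m
    using Tn[of \<tau> "nat m"] Tn[of "\<tau> + of_int m" "nat (- m)"] that by (cases "m \<ge> 0") simp_all
  \<comment> \<open>The number n bounds how many inversions are needed to reach height 4/5.\<close>
  have "Q \<tau>" if "Im \<tau> > 0" "Im \<tau> * (10 / 9) ^ n \<ge> 4 / 5" for n \<tau>
    using that
  proof (induction n arbitrary: \<tau>)
    case 0
    then show ?case using base by simp
  next
    case (Suc n)
    define \<sigma> where "\<sigma> = \<tau> + of_int (- round (Re \<tau>))"
    have \<sigma>: "Im \<sigma> = Im \<tau>" "\<bar>Re \<sigma>\<bar> \<le> 1 / 2"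
      using of_int_round_abs_le[of "Re \<tau>"] by (simp_all add: \<sigma>_def abs_minus_commute)
    show ?case
    proof (cases "Im \<tau> \<ge> 4 / 5")
      case True
      then show ?thesis by (rule base)
    next
      case False
      have "(Re \<sigma>)\<^sup>2 \<le> (1 / 2)\<^sup>2" using \<sigma>(2) abs_le_square_iff[of "Re \<sigma>" "1 / 2"] by simp
      moreover have "(Im \<sigma>)\<^sup>2 \<le> (4 / 5)\<^sup>2" using False Suc.prems \<sigma>(1) by (intro power_mono) auto
      ultimately have "(cmod \<sigma>)\<^sup>2 \<le> 9 / 10" unfolding cmod_power2 by (simp add: power2_eq_square)
      moreover have pos: "(cmod \<sigma>)\<^sup>2 > 0" using Suc.prems(1) \<sigma>(1) by auto
      ultimately have "Im \<sigma> * (10 / 9) \<le> Im (- 1 / \<sigma>)"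
        using Suc.prems(1) \<sigma>(1) unfolding Im_minus_inverse by (simp add: field_simps)
      then have "Im \<sigma> * (10 / 9) * (10 / 9) ^ n \<le> Im (- 1 / \<sigma>) * (10 / 9) ^ n"
        by (intro mult_right_mono) auto
      then have "4 / 5 \<le> Im (- 1 / \<sigma>) * (10 / 9) ^ n"
        using Suc.prems(2) \<sigma>(1) by (simp add: mult.assoc)
      moreover have "Im (- 1 / \<sigma>) > 0" unfolding Im_minus_inverse using Suc.prems(1) \<sigma>(1) pos by simp
      ultimately have "Q (- 1 / \<sigma>)" using Suc.IH by blast
      then have "Q \<sigma>" using S Suc.prems(1) \<sigma>(1) by simp
      then show ?thesis using Tz[OF Suc.prems(1)] unfolding \<sigma>_def by blast
    qed
  qed
  moreover obtain n where "4 / 5 / Im \<tau> < (10 / 9 :: real) ^ n"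
    using real_arch_pow[of "10/9" "4 / 5 / Im \<tau>"] by auto
  ultimately show ?thesis using \<tau> by (metis less_imp_le mult.commute pos_divide_less_eq)
qed

section \<open>A ternary form vanishing on the theta family\<close>

text \<open>Restricting to a, b < D leaves exactly D^2 distinct monomials, all of degree 2 D, and
  the subtraction in the third exponent never truncates.\<close>

definition ternary_form :: "nat \<Rightarrow> (nat \<times> nat \<Rightarrow> complex) \<Rightarrow> complex \<Rightarrow> complex \<Rightarrow> complex \<Rightarrow> complex" where
  "ternary_form D p x y z = (\<Sum>(a, b)\<in>{..<D} \<times> {..<D}. p (a, b) * (x ^ a * y ^ b * z ^ (2 * D - a - b)))"

lemma ternary_form_scale:
  "ternary_form D p (c * x) (c * y) (c * z) = c ^ (2 * D) * ternary_form D p x y z"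
  unfolding ternary_form_def sum_distrib_left
proof (rule sum.cong, safe)
  fix a b assume "a < D" "b < D"
  then have "c ^ (2 * D) = c ^ a * c ^ b * c ^ (2 * D - a - b)"
    by (simp flip: power_add)
  then show "p (a, b) * ((c * x) ^ a * (c * y) ^ b * (c * z) ^ (2 * D - a - b)) =
      c ^ (2 * D) * (p (a, b) * (x ^ a * y ^ b * z ^ (2 * D - a - b)))"
    by (simp add: power_mult_distrib mult_ac)
qed

definition theta_max :: "complex \<Rightarrow> real" where
  "theta_max \<tau> = Max ((\<lambda>h. cmod (h \<tau>)) ` theta_family)"

lemma theta_const_0_0_in_family: "theta_const 0 0 \<in> theta_family"
  by (rule theta_familyI[of 1 _ 0 0]) simp_all

lemma theta_max_ge: "h \<in> theta_family \<Longrightarrow> cmod (h \<tau>) \<le> theta_max \<tau>"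
  unfolding theta_max_def using finite_theta_family by (intro Max_ge) auto

lemma theta_max_attained: "\<exists>h\<in>theta_family. theta_max \<tau> = cmod (h \<tau>)"
proof -
  have "theta_max \<tau> \<in> (\<lambda>h. cmod (h \<tau>)) ` theta_family"
    unfolding theta_max_def using finite_theta_family theta_const_0_0_in_family by (intro Max_in) auto
  then show ?thesis by auto
qed

lemma theta_max_nonneg: "theta_max \<tau> \<ge> 0"
  using theta_max_attained[of \<tau>] by auto

text \<open>All triples are treated together because the modular group mixes them. The bound on the
  quotient is stated as a product, so that a zero of \<open>theta_max\<close> causes no
  trouble.\<close>

definition form_bounded :: "nat \<Rightarrow> (nat \<times> nat \<Rightarrow> complex) \<Rightarrow> real \<Rightarrow> complex \<Rightarrow> bool" where
  "form_bounded D p M \<tau> \<longleftrightarrow> (\<forall>h1\<in>theta_family. \<forall>h2\<in>theta_family. \<forall>h3\<in>theta_family.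
     cmod (ternary_form D p (h1 \<tau>) (h2 \<tau>) (h3 \<tau>)) \<le> M * theta_max \<tau> ^ (2 * D))"

text \<open>By \<open>up\<close> each triple at \<tau>, scaled by c, is a triple at \<sigma>, which
  scales the form by c^(2 D). By \<open>down\<close> the maximum at \<sigma> is at most |c| times
  the one at \<tau>. The powers of |c| cancel.\<close>

lemma form_bounded_transfer:
  assumes "c \<noteq> 0" "M \<ge> 0"
    and down: "\<forall>h\<in>theta_family. \<exists>h'\<in>theta_family. h \<sigma> = c * h' \<tau>"
    and up: "\<forall>h\<in>theta_family. \<exists>h'\<in>theta_family. c * h \<tau> = h' \<sigma>"
    and bd: "form_bounded D p M \<sigma>"
  shows "form_bounded D p M \<tau>"
  unfolding form_bounded_def
proof (intro ballI)
  fix h1 h2 h3 assume h: "h1 \<in> theta_family" "h2 \<in> theta_family" "h3 \<in> theta_family"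
  with up obtain g1 g2 g3 where g: "g1 \<in> theta_family" "g2 \<in> theta_family" "g3 \<in> theta_family"
    "c * h1 \<tau> = g1 \<sigma>" "c * h2 \<tau> = g2 \<sigma>" "c * h3 \<tau> = g3 \<sigma>" by metis
  obtain k where k: "k \<in> theta_family" "theta_max \<sigma> = cmod (k \<sigma>)" using theta_max_attained by blast
  obtain k' where k': "k' \<in> theta_family" "k \<sigma> = c * k' \<tau>" using down k(1) by blast
  have "theta_max \<sigma> \<le> cmod c * theta_max \<tau>"
    using theta_max_ge[OF k'(1), of \<tau>] by (simp add: k k' norm_mult mult_left_mono)
  then have le: "theta_max \<sigma> ^ (2 * D) \<le> (cmod c * theta_max \<tau>) ^ (2 * D)"
    using theta_max_nonneg by (intro power_mono) auto
  have "cmod c ^ (2 * D) * cmod (ternary_form D p (h1 \<tau>) (h2 \<tau>) (h3 \<tau>)) = cmod (ternary_form D p (g1 \<sigma>) (g2 \<sigma>) (g3 \<sigma>))"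
    unfolding g(4-6)[symmetric] ternary_form_scale by (simp add: norm_mult norm_power)
  also have "\<dots> \<le> M * theta_max \<sigma> ^ (2 * D)" using bd g(1-3) unfolding form_bounded_def by blast
  also have "\<dots> \<le> M * (cmod c * theta_max \<tau>) ^ (2 * D)" using le assms(2) by (intro mult_left_mono) auto
  also have "\<dots> = cmod c ^ (2 * D) * (M * theta_max \<tau> ^ (2 * D))" by (simp add: power_mult_distrib)
  finally show "cmod (ternary_form D p (h1 \<tau>) (h2 \<tau>) (h3 \<tau>)) \<le> M * theta_max \<tau> ^ (2 * D)"
    using assms(1) by (subst (asm) mult_le_cancel_left_pos) auto
qed

lemma form_bounded_everywhere:
  assumes M: "M \<ge> 0" and base: "\<And>\<tau>. Im \<tau> \<ge> 4 / 5 \<Longrightarrow> form_bounded D p M \<tau>" and \<tau>: "Im \<tau> > 0"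
  shows "form_bounded D p M \<tau>"
proof (rule modular_reduction[where Q = "form_bounded D p M", OF _ _ base \<tau>])
  fix \<tau> :: complex assume \<tau>: "Im \<tau> > 0"
  have T1: "\<forall>h\<in>theta_family. \<exists>h'\<in>theta_family. h (\<tau> + 1) = 1 * h' \<tau>"
    using theta_family_plus_one(1) by (metis mult_1)
  have T2: "\<forall>h\<in>theta_family. \<exists>h'\<in>theta_family. 1 * h \<tau> = h' (\<tau> + 1)"
    using theta_family_plus_one(2) by (metis mult_1)
  have T1': "\<forall>h\<in>theta_family. \<exists>h'\<in>theta_family. 1 * h (\<tau> + 1) = h' \<tau>" using T1 by simp
  have T2': "\<forall>h\<in>theta_family. \<exists>h'\<in>theta_family. h \<tau> = 1 * h' (\<tau> + 1)" using T2 by simp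
  show "form_bounded D p M (\<tau> + 1) \<longleftrightarrow> form_bounded D p M \<tau>"
    using form_bounded_transfer[OF _ M T1 T2] form_bounded_transfer[OF _ M T2' T1'] by auto
  obtain c where "c \<noteq> 0" "\<forall>h\<in>theta_family. \<exists>h'\<in>theta_family. h (- 1 / \<tau>) = c * h' \<tau>"
    "\<forall>h\<in>theta_family. \<exists>h'\<in>theta_family. c * h \<tau> = h' (- 1 / \<tau>)"
    using theta_family_inversion[OF \<tau>] by blast
  then show "form_bounded D p M \<tau>" if "form_bounded D p M (- 1 / \<tau>)"
    using form_bounded_transfer M that by blast
qed

lemma higher_deriv_lincomb:
  assumes "finite I" "\<And>i. i \<in> I \<Longrightarrow> f i holomorphic_on A" "open A" "z \<in> A"
  shows "(deriv ^^ n) (\<lambda>w. \<Sum>i\<in>I. p i * f i w) z = (\<Sum>i\<in>I. p i * (deriv ^^ n) (f i) z)"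
  using assms(1,2)
proof (induction I rule: finite_induct)
  case (insert i I)
  have "(deriv ^^ n) (\<lambda>w. p i * f i w + (\<Sum>i\<in>I. p i * f i w)) z
      = (deriv ^^ n) (\<lambda>w. p i * f i w) z + (deriv ^^ n) (\<lambda>w. \<Sum>i\<in>I. p i * f i w) z"
    using insert.prems by (intro higher_deriv_add[OF _ _ assms(3,4)] holomorphic_intros) auto
  also have "(deriv ^^ n) (\<lambda>w. p i * f i w) z = p i * (deriv ^^ n) (f i) z"
    using insert.prems by (intro higher_deriv_cmult[OF _ assms(4,3)]) auto
  finally show ?case using insert by simp
qed simp

lemma cmod_nome: "cmod (exp (pi * \<i> * \<tau> / 100)) = exp (- (pi * Im \<tau> / 100))"
  by simp

lemma theta_family_ternary_relation:
  "\<exists>D p. (\<exists>e\<in>{..<D} \<times> {..<D}. p e \<noteq> 0) \<and>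
     (\<forall>h1\<in>theta_family. \<forall>h2\<in>theta_family. \<forall>h3\<in>theta_family. \<forall>\<tau>. Im \<tau> > 0 \<longrightarrow>
        ternary_form D p (h1 \<tau>) (h2 \<tau>) (h3 \<tau>) = 0)"
proof -
  let ?\<Omega> = theta_family
  define q where "q \<tau> = exp (pi * \<i> * \<tau> / 100)" for \<tau> :: complex
  obtain G where G: "\<And>h. h \<in> ?\<Omega> \<Longrightarrow> G h holomorphic_on ball 0 1" "\<And>h \<tau>. h \<in> ?\<Omega> \<Longrightarrow> h \<tau> = G h (q \<tau>)"
    using theta_family_q_expansion unfolding q_def by metis
  \<comment> \<open>The moduli of q at the heights 4/5 and 1/2.\<close>
  define r0 r1 where "r0 = exp (- (pi / 125))" and "r1 = exp (- (pi / 200))"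
  have r: "0 < r0" "r0 < r1" "r1 < 1" "r0 < 1" "0 < r1" by (simp_all add: r0_def r1_def)
  have cG: "continuous_on (cball 0 s) (G h)" "continuous_on (sphere 0 s) (G h)" if "h \<in> ?\<Omega>" "s < 1" for h s
    using that by (auto intro!: holomorphic_on_imp_continuous_on holomorphic_on_subset[OF G(1)])
  have "bounded (\<Union>h\<in>?\<Omega>. G h ` sphere 0 r1)"
    using finite_theta_family cG(2) r by (intro bounded_UN ballI compact_imp_bounded compact_continuous_image) auto
  then obtain B where B: "B > 0" "\<And>h z. h \<in> ?\<Omega> \<Longrightarrow> cmod z = r1 \<Longrightarrow> cmod (G h z) \<le> B"
    unfolding bounded_pos by (auto simp: dist_norm)
  \<comment> \<open>In 12 = 2 * 6 the factor 6 offsets the lower bound 1/6 of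
    \<open>theta_max\<close>, and the factor 2 produces the halving.\<close>
  obtain L where "(r0 / r1) ^ L < 1 / (12 * B)"
    using real_arch_pow_inv[of "1 / (12 * B)" "r0 / r1"] B(1) r by auto
  then have L: "B * (r0 / r1) ^ L \<le> 1 / 12" using B(1) by (simp add: field_simps)
  define K where "K = card ?\<Omega>"
  \<comment> \<open>There are K^3 triples with m = 2 D L derivatives each, hence D (2 L K^3)
    equations, fewer than the D^2 unknowns.\<close>
  define D where "D = 2 * L * K ^ 3 + 1"
  define m where "m = 2 * D * L"
  define I where "I = {..<D} \<times> {..<D}"
  define mon where "mon t e z = G (fst t) z ^ fst e * G (fst (snd t)) z ^ snd e * G (snd (snd t)) z ^ (2 * D - fst e - snd e)"
    for t :: "(complex \<Rightarrow> complex) \<times> (complex \<Rightarrow> complex) \<times> (complex \<Rightarrow> complex)" and e z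
  have "card ((?\<Omega> \<times> ?\<Omega> \<times> ?\<Omega>) \<times> {..<m}) = D * (2 * L * K ^ 3)"
    by (simp add: card_cartesian_product K_def m_def power3_eq_cube mult_ac)
  also have "\<dots> < card I" by (simp add: I_def card_cartesian_product D_def)
  finally obtain p where p: "\<exists>e\<in>I. p e \<noteq> 0"
    "\<And>t n. t \<in> ?\<Omega> \<times> ?\<Omega> \<times> ?\<Omega> \<Longrightarrow> n < m \<Longrightarrow> (\<Sum>e\<in>I. (deriv ^^ n) (mon t e) 0 * p e) = 0"
    using homogeneous_system_solution[of "(?\<Omega> \<times> ?\<Omega> \<times> ?\<Omega>) \<times> {..<m}" I "\<lambda>(t, n) e. (deriv ^^ n) (mon t e) 0"]
      finite_theta_family unfolding I_def by fastforce
  define F where "F t z = (\<Sum>e\<in>I. p e * mon t e z)" for t z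
  have form: "ternary_form D p (h1 \<tau>) (h2 \<tau>) (h3 \<tau>) = F (h1, h2, h3) (q \<tau>)"
    if "h1 \<in> ?\<Omega>" "h2 \<in> ?\<Omega>" "h3 \<in> ?\<Omega>" for h1 h2 h3 \<tau>
    unfolding ternary_form_def F_def I_def mon_def using that by (simp add: G(2) case_prod_unfold)
  have hol_mon: "mon t e holomorphic_on ball 0 1" if "t \<in> ?\<Omega> \<times> ?\<Omega> \<times> ?\<Omega>" for t e
    unfolding mon_def using that by (intro holomorphic_intros G(1)) auto
  have hol: "F t holomorphic_on ball 0 1" if "t \<in> ?\<Omega> \<times> ?\<Omega> \<times> ?\<Omega>" for t
    unfolding F_def using hol_mon[OF that] by (intro holomorphic_intros) auto
  have van: "(deriv ^^ n) (F t) 0 = 0" if "t \<in> ?\<Omega> \<times> ?\<Omega> \<times> ?\<Omega>" "n < m" for t n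
  proof -
    have "(deriv ^^ n) (F t) 0 = (\<Sum>e\<in>I. p e * (deriv ^^ n) (mon t e) 0)"
      unfolding F_def using hol_mon[OF that(1)] by (intro higher_deriv_lincomb) (auto simp: I_def)
    then show ?thesis using p(2)[OF that] by (simp add: mult.commute)
  qed
  have low: "1 / 6 \<le> theta_max \<tau>" if "Im \<tau> \<ge> 4 / 5" for \<tau>
    using theta_const_0_0_lower_bound[OF that] theta_max_ge[OF theta_const_0_0_in_family, of \<tau>] by linarith
  have q0: "cmod (q \<tau>) \<le> r0" if "Im \<tau> \<ge> 4 / 5" for \<tau>
    unfolding q_def cmod_nome r0_def using mult_left_mono[OF that, of pi] by simp
  \<comment> \<open>A first bound, of any size, exists by compactness: the closed disk |q| <= r0
    contains the cusp q = 0.\<close>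
  have "\<exists>C. C \<ge> 0 \<and> (\<forall>\<tau>. Im \<tau> \<ge> 4 / 5 \<longrightarrow> form_bounded D p C \<tau>)"
  proof -
    have "continuous_on (cball 0 r0) (F t)" if "t \<in> ?\<Omega> \<times> ?\<Omega> \<times> ?\<Omega>" for t
      using r by (intro holomorphic_on_imp_continuous_on holomorphic_on_subset[OF hol[OF that]]) auto
    then have "bounded (\<Union>t\<in>?\<Omega> \<times> ?\<Omega> \<times> ?\<Omega>. F t ` cball 0 r0)"
      using finite_theta_family by (intro bounded_UN ballI compact_imp_bounded compact_continuous_image) auto
    then obtain C where C: "C > 0" "\<And>t z. t \<in> ?\<Omega> \<times> ?\<Omega> \<times> ?\<Omega> \<Longrightarrow> cmod z \<le> r0 \<Longrightarrow> cmod (F t z) \<le> C"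
      unfolding bounded_pos by fastforce
    have "form_bounded D p (C * 6 ^ (2 * D)) \<tau>" if \<tau>: "Im \<tau> \<ge> 4 / 5" for \<tau>
      unfolding form_bounded_def
    proof (intro ballI)
      fix h1 h2 h3 assume h: "h1 \<in> ?\<Omega>" "h2 \<in> ?\<Omega>" "h3 \<in> ?\<Omega>"
      have "cmod (ternary_form D p (h1 \<tau>) (h2 \<tau>) (h3 \<tau>)) \<le> C"
        unfolding form[OF h] using h q0[OF \<tau>] by (intro C(2)) auto
      also have "C = C * 6 ^ (2 * D) * (1 / 6) ^ (2 * D)" by (simp add: power_divide)
      also have "\<dots> \<le> C * 6 ^ (2 * D) * theta_max \<tau> ^ (2 * D)"
        using low[OF \<tau>] C(1) by (intro mult_left_mono power_mono) auto
      finally show "cmod (ternary_form D p (h1 \<tau>) (h2 \<tau>) (h3 \<tau>)) \<le> C * 6 ^ (2 * D) * theta_max \<tau> ^ (2 * D)" .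
    qed
    then show ?thesis using C(1) by (intro exI[of _ "C * 6 ^ (2 * D)"]) auto
  qed
  then obtain M where M: "M \<ge> 0" "\<And>\<tau>. Im \<tau> \<ge> 4 / 5 \<Longrightarrow> form_bounded D p M \<tau>" by blast
  \<comment> \<open>On the circle |q| = r1 the form is at most M B^(2 D). The zero of order m = 2 D
    L at the cusp contributes (r0 / r1)^m on the smaller disk, and by the choice of L the product is
    at most M / 12^(2 D).\<close>
  have halve: "form_bounded D p (M / 2) \<tau>"
    if M: "M \<ge> 0" "\<And>\<tau>. Im \<tau> > 0 \<Longrightarrow> form_bounded D p M \<tau>" and \<tau>: "Im \<tau> \<ge> 4 / 5" for M \<tau>
    unfolding form_bounded_def
  proof (intro ballI)
    fix h1 h2 h3 assume h: "h1 \<in> ?\<Omega>" "h2 \<in> ?\<Omega>" "h3 \<in> ?\<Omega>"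
    let ?t = "(h1, h2, h3)"
    have t: "?t \<in> ?\<Omega> \<times> ?\<Omega> \<times> ?\<Omega>" using h by simp
    have circle: "cmod (F ?t z) \<le> M * B ^ (2 * D)" if z: "cmod z = r1" for z
    proof -
      \<comment> \<open>A logarithm of z provides a point of height 1/2 over z, so the assumed bound
        in the half-plane applies on the whole circle.\<close>
      define \<sigma> where "\<sigma> = 100 * Ln z / (pi * \<i>)"
      have "z \<noteq> 0" using z r by auto
      then have q\<sigma>: "q \<sigma> = z" by (simp add: q_def \<sigma>_def)
      then have "exp (- (pi * Im \<sigma> / 100)) = exp (- (pi / 200))"
        using cmod_nome[of \<sigma>] z by (simp only: q_def r1_def)
      then have im: "Im \<sigma> = 1 / 2" by simp
      obtain h where "h \<in> ?\<Omega>" "theta_max \<sigma> = cmod (h \<sigma>)" using theta_max_attained by blast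
      then have "theta_max \<sigma> \<le> B" using B(2) z q\<sigma> by (simp add: G(2))
      then have "theta_max \<sigma> ^ (2 * D) \<le> B ^ (2 * D)" using theta_max_nonneg by (intro power_mono)
      moreover have "cmod (F ?t z) \<le> M * theta_max \<sigma> ^ (2 * D)"
        using M(2)[of \<sigma>] h im form[OF h, of \<sigma>] q\<sigma> unfolding form_bounded_def by fastforce
      ultimately show ?thesis using M(1) by (meson mult_left_mono order_trans)
    qed
    have "cmod (F ?t (q \<tau>)) \<le> M * B ^ (2 * D) * (cmod (q \<tau>) / r1) ^ m"
      using holomorphic_vanishing_bound[OF hol[OF t] van[OF t] r(5,3) circle] q0[OF \<tau>] r by auto
    also have "\<dots> \<le> M * B ^ (2 * D) * (r0 / r1) ^ m"
      using q0[OF \<tau>] r M(1) B(1) by (intro mult_left_mono power_mono divide_right_mono) auto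
    also have "\<dots> = M * (B * (r0 / r1) ^ L) ^ (2 * D)"
      by (simp add: m_def power_mult_distrib power_mult[symmetric] mult.commute)
    also have "\<dots> \<le> M * (1 / 12) ^ (2 * D)"
      using L M(1) B(1) r by (intro mult_left_mono power_mono) auto
    also have "\<dots> = M * ((1 / 2) ^ (2 * D) * (1 / 6) ^ (2 * D))"
      by (simp flip: power_mult_distrib)
    also have "\<dots> \<le> M * (1 / 2 * theta_max \<tau> ^ (2 * D))"
    proof -
      have "(1 / 2 :: real) ^ (2 * D) \<le> (1 / 2) ^ 1" by (rule power_decreasing) (auto simp: D_def)
      moreover have "(1 / 6) ^ (2 * D) \<le> theta_max \<tau> ^ (2 * D)" using low[OF \<tau>] by (intro power_mono) auto
      ultimately show ?thesis using M(1) by (intro mult_left_mono mult_mono) auto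
    qed
    finally show "cmod (ternary_form D p (h1 \<tau>) (h2 \<tau>) (h3 \<tau>)) \<le> M / 2 * theta_max \<tau> ^ (2 * D)"
      unfolding form[OF h] by simp
  qed
  \<comment> \<open>Each halved bound near the cusp spreads to the half-plane by
    \<open>form_bounded_everywhere\<close> and can then be halved again.\<close>
  have all: "form_bounded D p (M / 2 ^ n) \<tau>" if "Im \<tau> > 0" for n \<tau>
    using that
  proof (induction n arbitrary: \<tau>)
    case 0
    then show ?case using form_bounded_everywhere[OF M] by simp
  next
    case (Suc n)
    have nn: "0 \<le> M / 2 ^ n" using M(1) by simp
    then have "form_bounded D p (M / 2 ^ n / 2) \<tau>"
      using form_bounded_everywhere[OF _ halve[OF nn Suc.IH] Suc.prems] by simp
    then show ?case by (simp add: mult.commute)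
  qed
  have "ternary_form D p (h1 \<tau>) (h2 \<tau>) (h3 \<tau>) = 0"
    if h: "h1 \<in> ?\<Omega>" "h2 \<in> ?\<Omega>" "h3 \<in> ?\<Omega>" and \<tau>: "Im \<tau> > 0" for h1 h2 h3 \<tau>
  proof -
    have "(\<lambda>n. M / 2 ^ n * theta_max \<tau> ^ (2 * D)) \<longlonglongrightarrow> 0 * theta_max \<tau> ^ (2 * D)"
      by (intro tendsto_mult_right LIMSEQ_divide_realpow_zero) auto
    moreover have "cmod (ternary_form D p (h1 \<tau>) (h2 \<tau>) (h3 \<tau>)) \<le> M / 2 ^ n * theta_max \<tau> ^ (2 * D)" for n
      using all[OF \<tau>] h unfolding form_bounded_def by blast
    ultimately have "cmod (ternary_form D p (h1 \<tau>) (h2 \<tau>) (h3 \<tau>)) \<le> 0"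
      by (intro LIMSEQ_le_const) auto
    then show ?thesis by simp
  qed
  then show ?thesis using p(1) unfolding I_def by blast
qed

section \<open>Algebraic dependence\<close>

lemma monom_eval_superset:
  assumes "finite A" "Poly_Mapping.keys m \<subseteq> A"
  shows "monom_eval m x = (\<Prod>v\<in>A. x v ^ Poly_Mapping.lookup m v)"
  unfolding monom_eval_def using assms
  by (intro prod.mono_neutral_left) (auto simp: in_keys_iff)

lemma cpoly_eval_superset:
  assumes "finite A" "Poly_Mapping.keys P \<subseteq> A"
  shows "cpoly_eval P x = (\<Sum>m\<in>A. Poly_Mapping.lookup P m * monom_eval m x)"
  unfolding cpoly_eval_def using assms
  by (intro sum.mono_neutral_left) (auto simp: in_keys_iff)

text \<open>Injectivity of m keeps the terms of the relation from merging, so \<open>p e\<close>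
  really is a coefficient of P and P is not 0.\<close>

lemma not_alg_indep_onI:
  fixes m :: "'e \<Rightarrow> 'v \<Rightarrow>\<^sub>0 nat" and p :: "'e \<Rightarrow> complex"
  assumes E: "finite E" "inj_on m E" and e: "e \<in> E" "p e \<noteq> 0"
    and keys: "\<And>e. e \<in> E \<Longrightarrow> Poly_Mapping.keys (m e) \<subseteq> S"
    and rel: "\<And>\<tau>. \<tau> \<in> U \<Longrightarrow> (\<Sum>e\<in>E. p e * monom_eval (m e) (\<lambda>s. f s \<tau>)) = 0"
  shows "\<not> alg_indep_on U S f"
proof
  assume ind: "alg_indep_on U S f"
  define P :: "'v cpoly" where "P = (\<Sum>e\<in>E. Poly_Mapping.single (m e) (p e))"
  have lookup: "Poly_Mapping.lookup P (m e) = p e" if "e \<in> E" for e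
  proof -
    have "Poly_Mapping.lookup P (m e) = (\<Sum>e'\<in>E. p e' when m e' = m e)"
      by (simp add: P_def lookup_sum lookup_single)
    also have "\<dots> = (\<Sum>e'\<in>E. if e' = e then p e' else 0)"
      using E(2) that by (intro sum.cong) (auto simp: when_def inj_on_def)
    finally show ?thesis using E(1) that by simp
  qed
  have kP: "Poly_Mapping.keys P \<subseteq> m ` E"
    unfolding P_def using keys_sum[of "\<lambda>e. Poly_Mapping.single (m e) (p e)" E] by (auto split: if_splits)
  have "cpoly_eval P (\<lambda>s. f s \<tau>) = 0" if "\<tau> \<in> U" for \<tau>
  proof -
    have "cpoly_eval P (\<lambda>s. f s \<tau>) = (\<Sum>e\<in>E. p e * monom_eval (m e) (\<lambda>s. f s \<tau>))"
      using E kP lookup by (simp add: cpoly_eval_superset[of "m ` E"] sum.reindex)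
    then show ?thesis using rel[OF that] by simp
  qed
  moreover have "\<forall>k\<in>Poly_Mapping.keys P. Poly_Mapping.keys k \<subseteq> S" using kP keys by blast
  ultimately have "P = 0" using ind unfolding alg_indep_on_def by blast
  then show False using lookup[OF e(1)] e(2) by simp
qed

lemma twelve_chars_in_family:
  assumes "(e, e') \<in> twelve_chars"
  shows "theta_const e e' \<in> theta_family"
proof -
  obtain j k :: int where jk: "e = of_int j / 5" "e' = of_int k / 5"
  proof -
    \<comment> \<open>The first characteristic 1 is written as 5/5, which brings both kinds of
      characteristics into one form.\<close>
    from assms have "\<exists>j\<in>{1, 3, 5 :: int}. \<exists>k\<in>{1, 3, 5, 7, 9 :: int}. e = of_int j / 5 \<and> e' = of_int k / 5"
      unfolding twelve_chars_def by auto
    then show thesis using that by blast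
  qed
  show ?thesis unfolding jk by (rule theta_familyI[of 1 _ j k]) simp_all
qed

text \<open>The common form becomes a polynomial in three distinct elements of S with the same
  coefficients, and a relation among three elements is already a relation on S.\<close>

theorem alg_indep_twelve_chars_card_le_2:
  assumes S: "S \<subseteq> twelve_chars" and ind: "alg_indep_on upper_half_plane S (\<lambda>(e, e'). theta_const e e')"
  shows "card S \<le> 2"
proof (rule ccontr)
  let ?f = "\<lambda>(e, e'). theta_const e e'"
  assume "\<not> card S \<le> 2"
  then obtain T where T: "T \<subseteq> S" "card T = 3"
    using obtain_subset_with_card_n[of 3 S] by auto
  then obtain s1 s2 s3 where T3: "T = {s1, s2, s3}" and ne: "s1 \<noteq> s2" "s1 \<noteq> s3" "s2 \<noteq> s3"
    unfolding card_3_iff by blast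
  have fam: "?f s \<in> theta_family" if "s \<in> T" for s
    using that T(1) S twelve_chars_in_family by (cases s) auto
  obtain D p e where e: "e \<in> {..<D} \<times> {..<D}" "p e \<noteq> 0"
    and rel: "\<And>h1 h2 h3 \<tau>. h1 \<in> theta_family \<Longrightarrow> h2 \<in> theta_family \<Longrightarrow> h3 \<in> theta_family \<Longrightarrow> Im \<tau> > 0
       \<Longrightarrow> ternary_form D p (h1 \<tau>) (h2 \<tau>) (h3 \<tau>) = 0"
    using theta_family_ternary_relation by blast
  define m where "m = (\<lambda>(a, b). Poly_Mapping.single s1 a + Poly_Mapping.single s2 b
    + Poly_Mapping.single s3 (2 * D - a - b :: nat))"
  have lookup: "Poly_Mapping.lookup (m (a, b)) s1 = a" "Poly_Mapping.lookup (m (a, b)) s2 = b"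
    "Poly_Mapping.lookup (m (a, b)) s3 = 2 * D - a - b" for a b
    using ne by (auto simp: m_def lookup_add lookup_single)
  have keys: "Poly_Mapping.keys (m e) \<subseteq> {s1, s2, s3}" for e
    unfolding m_def by (cases e) (auto simp: in_keys_iff lookup_add lookup_single when_def split: if_splits)
  have "inj_on m ({..<D} \<times> {..<D})"
    using lookup by (intro inj_onI) (metis surj_pair)
  moreover have "Poly_Mapping.keys (m e) \<subseteq> S" for e using keys T(1) T3 by blast
  moreover have "(\<Sum>e\<in>{..<D} \<times> {..<D}. p e * monom_eval (m e) (\<lambda>s. ?f s \<tau>)) = 0"
    if "\<tau> \<in> upper_half_plane" for \<tau>
  proof -
    have "monom_eval (m (a, b)) (\<lambda>s. ?f s \<tau>) = ?f s1 \<tau> ^ a * ?f s2 \<tau> ^ b * ?f s3 \<tau> ^ (2 * D - a - b)" for a b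
      using ne by (subst monom_eval_superset[OF _ keys]) (simp_all add: lookup mult.assoc)
    then have "(\<Sum>e\<in>{..<D} \<times> {..<D}. p e * monom_eval (m e) (\<lambda>s. ?f s \<tau>))
        = ternary_form D p (?f s1 \<tau>) (?f s2 \<tau>) (?f s3 \<tau>)"
      unfolding ternary_form_def by (intro sum.cong) auto
    also have "\<dots> = 0"
      using that by (intro rel fam) (auto simp: T3 upper_half_plane_def)
    finally show ?thesis .
  qed
  ultimately have "\<not> alg_indep_on upper_half_plane S ?f"
    using e by (intro not_alg_indep_onI[where m = m and p = p and E = "{..<D} \<times> {..<D}"]) auto
  then show False using ind by blast
qed

theorem theorem8p2:
  assumes "S \<subseteq> twelve_chars"
    and "alg_indep_on upper_half_plane S (\<lambda>(e, e'). theta_const e e')"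
  shows "card S \<le> 5"
  using alg_indep_twelve_chars_card_le_2[OF assms] by simp

end
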